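(* Let $\vartheta$ be the rumour constant, i.e. the unique solution in $(0,1)$ of $-\log\vartheta=2(1-\vartheta)$. For $n\ge1$ define $$V_n(0)=\frac1n\left(1+2\sum_{k=2}^n\frac1k\right),\qquad V_n(r)=\frac{2r}{n}\left(\sum_{j=r}^{n-1}\frac1j+\frac rn-1\right)\quad(1\le r\le n),$$ and for $2\le r\le n$ let $D_n(r)=\frac{n^2}{2}\bigl(V_n(r)-V_n(r-1)\bigr)$. Put $$A=2-\frac1\vartheta,\qquad c=\frac{1-3\vartheta}{2(1-2\vartheta)}.$$ Then: 1. for every $n$ the sequence $\{V_n(r)\}_{r=1}^n$ is unimodal; 2. $A<0$, $0<c<\frac12$, and uniformly for bounded $u$ such that $\vartheta n+u$ is an integer in $\{2,\dots,n\}$, $$D_n(\vartheta n+u)=A(u-c)+O(n^{-1})\qquad(n\to\infty);$$ 3. if $(p_j,q_j)$ are integer pairs with $q_j\to\infty$ and $p_j-\vartheta q_j\to0$, then for all sufficiently large $j$, $p_j$ is the unique maximizer over $\{0,\dots,q_j\}$ of $V_{q_j}$, i.e. the unique optimal threshold for the uniform random-horizon Best-or-Worst problem with upper horizon $q_j$; and $p_j$ is also the unique optimal threshold over $\{0,\dots,q_j\}$ for the uniform random-horizon Postdoc problem with upper horizon $q_j$.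
   Context: Empty sums are zero. A finite sequence indexed by consecutive integers is unimodal if it is nondecreasing up to some index, constant up to a later (or equal) index, and nonincreasing afterwards. "Uniformly for bounded $u$" means: for each $M>0$ there are $K,n_0$ such that the error is at most $K/n$ for all $n\ge n_0$ and all admissible $u$ with $|u|\le M$. Models: the number $N$ of applicants is uniform on $\{1,\dots,n\}$, arriving in uniformly random order; the rule with threshold $r$ rejects the first $r$ applicants. Best-or-Worst: success means selecting the best or the worst applicant; the function $V_n(r)$ above is the success probability with threshold $r$ (for fixed horizon $k$ the success probability is $\frac{2r(k-r)}{k(k-1)}$ for $1\le r<k$). Postdoc: success means selecting the second best applicant; its success probability with threshold $r$ equals $\frac12V_n(r)$ for $2\le r\le n$ (a known fact to be taken as given), and at the exceptional thresholds $r=0,1$ it is $O((\log n)/n)$. *)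

theory Defs
  imports "HOL-Probability.Probability" "HOL-Combinatorics.Permutations"
begin

definition rumour_const :: real where
  "rumour_const = (THE x. 0 < x \<and> x < 1 \<and> - ln x = 2 * (1 - x))"

definition V :: "nat \<Rightarrow> nat \<Rightarrow> real" where
  "V n r = (if r = 0 then 1 / real n * (1 + 2 * (\<Sum>k=2..n. 1 / real k))
            else 2 * real r / real n * ((\<Sum>j=r..<n. 1 / real j) + real r / real n - 1))"

text \<open>Only used for \<open>2 \<le> r \<le> n\<close>.\<close>
definition D :: "nat \<Rightarrow> nat \<Rightarrow> real" where
  "D n r = (real n)\<^sup>2 / 2 * (V n r - V n (r - 1))"

definition unimodal_on :: "nat \<Rightarrow> nat \<Rightarrow> (nat \<Rightarrow> real) \<Rightarrow> bool" where
  "unimodal_on a b f \<longleftrightarrow>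
     (\<exists>s t. a \<le> s \<and> s \<le> t \<and> t \<le> b \<and>
        mono_on {a..s} f \<and> f constant_on {s..t} \<and> antimono_on {t..b} f)"

definition unique_maximizer :: "('a \<Rightarrow> real) \<Rightarrow> 'a set \<Rightarrow> 'a \<Rightarrow> bool" where
  "unique_maximizer f S x \<longleftrightarrow> (\<forall>y. is_arg_max f (\<lambda>z. z \<in> S) y \<longleftrightarrow> y = x)"

text \<open>
  Among \<open>k\<close> applicants, \<open>\<sigma> i\<close> is the absolute rank of the \<open>i\<close>-th arrival: rank 1 is the best,
  rank \<open>k\<close> the worst. A sample point is the pair of the number of applicants and
  their ranks in order of arrival.
\<close>
definition random_horizon :: "nat \<Rightarrow> (nat \<times> (nat \<Rightarrow> nat)) pmf" where
  "random_horizon n =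
     bind_pmf (pmf_of_set {1..n}) (\<lambda>k.
       map_pmf (Pair k) (pmf_of_set {\<sigma>. \<sigma> permutes {1..k}}))"

definition relative_rank :: "(nat \<Rightarrow> nat) \<Rightarrow> nat \<Rightarrow> nat" where
  "relative_rank \<sigma> i = card {j \<in> {1..i}. \<sigma> j \<le> \<sigma> i}"

text \<open>
  The rule with threshold \<open>r\<close> rejects the first \<open>r\<close> applicants and then selects the first
  one that satisfies the candidate condition \<open>C\<close>; nobody is selected if there is no such
  applicant among the \<open>k\<close> that arrive, in particular if \<open>k \<le> r\<close>.
\<close>
definition threshold_selects :: "nat \<Rightarrow> nat \<Rightarrow> (nat \<Rightarrow> bool) \<Rightarrow> nat \<Rightarrow> bool" where
  "threshold_selects r k C i \<longleftrightarrow> r < i \<and> i \<le> k \<and> C i \<and> (\<forall>j. r < j \<and> j < i \<longrightarrow> \<not> C j)"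

text \<open>In each problem a candidate is an applicant of the desired kind among those seen so far.\<close>

definition best_or_worst_prob :: "nat \<Rightarrow> nat \<Rightarrow> real" where
  "best_or_worst_prob n r =
     measure_pmf.prob (random_horizon n)
       {(k, \<sigma>). \<exists>i. threshold_selects r k
                      (\<lambda>i. relative_rank \<sigma> i = 1 \<or> relative_rank \<sigma> i = i) i \<and>
                    (\<sigma> i = 1 \<or> \<sigma> i = k)}"

definition postdoc_prob :: "nat \<Rightarrow> nat \<Rightarrow> real" where
  "postdoc_prob n r =
     measure_pmf.prob (random_horizon n)
       {(k, \<sigma>). \<exists>i. threshold_selects r k (\<lambda>i. relative_rank \<sigma> i = 2) i \<and> \<sigma> i = 2}"

end

theory Submission
  imports Defs
begin

text \<open>
  The differences \<open>D n r\<close> are \<open>n (\<Sum>j=r..<n. 1 / j) - 2 n + 2 r - 1\<close>, and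
  \<open>D n (r + 1) - D n r = 2 - n / r\<close>, so \<open>D n\<close> decreases up to \<open>n / 2\<close> and then increases to the
  final value \<open>D n n = -1\<close>. Hence it changes sign at most once, from positive to negative: \<open>V n\<close> is
  unimodal, and \<open>p\<close> is the only maximizer as soon as \<open>D n p > 0 > D n (p + 1)\<close>. The trapezoidal
  approximation of the harmonic tail by \<open>ln (n / r)\<close> gives the linear expansion of \<open>D n\<close> around
  \<open>\<theta> n\<close>, whose zero \<open>c\<close> lies strictly between 0 and 1.

  The success probabilities are computed from the fact that relative ranks set up a bijection between
  permutations and the product of the sets \<open>{1..i}\<close>, so that the relative ranks are independent and
  uniform. The Postdoc probability equals \<open>V n r / 2\<close> even for \<open>r = 1\<close>, and the first arrival is never
  a Postdoc candidate, so threshold 0 performs like threshold 1.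
\<close>

section \<open>Relative ranks\<close>

lemma relative_rank_in_range:
  "i \<ge> 1 \<Longrightarrow> relative_rank \<sigma> i \<in> {1..i}"
proof -
  assume i: "i \<ge> 1"
  have "card {j \<in> {1..i}. \<sigma> j \<le> \<sigma> i} \<le> card {1..i}" by (rule card_mono) auto
  moreover have "card {i} \<le> card {j \<in> {1..i}. \<sigma> j \<le> \<sigma> i}" by (rule card_mono) (use i in auto)
  ultimately show ?thesis by (simp add: relative_rank_def)
qed

text \<open>Passing from \<open>x\<close> to a larger \<open>y\<close> in \<open>S\<close> gains at
  least \<open>y\<close> itself, so the count is strictly increasing on \<open>S\<close>.\<close>

lemma card_below_inj:
  fixes S :: "'a::linorder set"
  assumes "finite S" "x \<in> S" "y \<in> S" "card {z \<in> S. z \<le> x} = card {z \<in> S. z \<le> y}"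
  shows "x = y"
proof -
  have *: False if "x < y" "x \<in> S" "y \<in> S" "card {z \<in> S. z \<le> x} = card {z \<in> S. z \<le> y}" for x y
  proof -
    have "{z \<in> S. z \<le> x} \<subset> {z \<in> S. z \<le> y}" using that by (force simp: psubset_eq)
    then have "card {z \<in> S. z \<le> x} < card {z \<in> S. z \<le> y}"
      by (intro psubset_card_mono) (use assms in auto)
    with that show False by simp
  qed
  show ?thesis using *[of x y] *[of y x] assms by (metis linorder_less_linear)
qed

text \<open>Written with values instead of positions, the relative rank depends only on the set of
  the first \<open>i\<close> values and on \<open>\<sigma> i\<close>, not on the order of the
  earlier ones.\<close>

lemma relative_rank_eq_card_image:
  assumes "inj \<sigma>"
  shows "relative_rank \<sigma> i = card {z \<in> \<sigma> ` {1..i}. z \<le> \<sigma> i}"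
proof -
  have "{z \<in> \<sigma> ` {1..i}. z \<le> \<sigma> i} = \<sigma> ` {j \<in> {1..i}. \<sigma> j \<le> \<sigma> i}" by auto
  then show ?thesis unfolding relative_rank_def using assms by (simp add: card_image inj_on_subset)
qed

text \<open>Ranks are decoded from the last arrival backwards: the values after position
  \<open>m\<close> leave a known set for the first \<open>m\<close> positions, and the relative rank
  of \<open>m\<close> singles out one element of it.\<close>

lemma permutes_eq_if_relative_rank_eq:
  assumes \<sigma>: "\<sigma> permutes {1..k}" and \<tau>: "\<tau> permutes {1..k}"
    and eq: "\<And>i. i \<in> {1..k} \<Longrightarrow> relative_rank \<sigma> i = relative_rank \<tau> i"
  shows "\<sigma> = \<tau>"
proof -
  \<comment> \<open>\<open>d\<close> counts the last positions of \<open>{1..k}\<close> on which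
    agreement is known; the case \<open>d = 0\<close> concerns positions beyond \<open>k\<close>,
    which both permutations fix.\<close>
  have "\<forall>i. i > k - d \<longrightarrow> \<sigma> i = \<tau> i" if "d \<le> k" for d
    using that
  proof (induction d)
    case 0
    then show ?case using \<sigma> \<tau> by (auto simp: permutes_def)
  next
    case (Suc d)
    then have IH: "\<And>i. i > k - d \<Longrightarrow> \<sigma> i = \<tau> i" by simp
    let ?m = "k - d"
    have m: "?m \<in> {1..k}" using Suc.prems by auto
    have im: "\<rho> ` {1..?m} = {1..k} - \<rho> ` {?m<..k}" if "\<rho> permutes {1..k}" for \<rho>
    proof -
      have "{1..k} = {1..?m} \<union> {?m<..k}" using m by auto
      then have "{1..k} = \<rho> ` {1..?m} \<union> \<rho> ` {?m<..k}"
        by (metis image_Un permutes_image[OF that])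
      moreover have "\<rho> ` {1..?m} \<inter> \<rho> ` {?m<..k} = {}"
        using permutes_inj[OF that] by (auto simp: inj_eq)
      ultimately show ?thesis by blast
    qed
    have S: "\<sigma> ` {1..?m} = \<tau> ` {1..?m}"
      unfolding im[OF \<sigma>] im[OF \<tau>] using IH by (auto simp: image_iff)
    have "\<sigma> ?m = \<tau> ?m"
    proof (rule card_below_inj)
      show "finite (\<sigma> ` {1..?m})" by simp
      show "\<sigma> ?m \<in> \<sigma> ` {1..?m}" using m by auto
      show "\<tau> ?m \<in> \<sigma> ` {1..?m}" unfolding S using m by auto
      show "card {z \<in> \<sigma> ` {1..?m}. z \<le> \<sigma> ?m} = card {z \<in> \<sigma> ` {1..?m}. z \<le> \<tau> ?m}"
        using eq[OF m] relative_rank_eq_card_image[OF permutes_inj[OF \<sigma>], of ?m]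
          relative_rank_eq_card_image[OF permutes_inj[OF \<tau>], of ?m] S by simp
    qed
    then show ?case using IH Suc.prems by (metis Suc_diff_Suc Suc_le_lessD Suc_lessI less_Suc_eq_le not_less_eq)
  qed
  from this[of k] have "\<forall>i>0. \<sigma> i = \<tau> i" by simp
  moreover have "\<sigma> 0 = \<tau> 0" using \<sigma> \<tau> by (auto simp: permutes_def)
  ultimately show ?thesis by (metis ext gr0I)
qed

lemma finite_nonempty_permutations: "finite {\<sigma>. \<sigma> permutes {1..k::nat}}" "{\<sigma>. \<sigma> permutes {1..k}} \<noteq> {}"
  using permutes_id[of "{1..k}"] by (blast intro: finite_permutations)+

text \<open>An injection between sets of the same size \<open>k!\<close> is onto; this is a Lehmer
  code. \<open>restrict\<close> discards the values outside \<open>{1..k}\<close>, so that the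
  images are extensional functions.\<close>

lemma bij_betw_relative_rank:
  "bij_betw (\<lambda>\<sigma>. restrict (relative_rank \<sigma>) {1..k}) {\<sigma>. \<sigma> permutes {1..k}} (PiE {1..k} (\<lambda>i. {1..i}))"
proof (rule bij_betw_imageI)
  let ?f = "\<lambda>\<sigma>. restrict (relative_rank \<sigma>) {1..k}"
  show inj: "inj_on ?f {\<sigma>. \<sigma> permutes {1..k}}"
    by (rule inj_onI) (metis mem_Collect_eq permutes_eq_if_relative_rank_eq restrict_apply')
  show "?f ` {\<sigma>. \<sigma> permutes {1..k}} = PiE {1..k} (\<lambda>i. {1..i})"
  proof (rule card_subset_eq)
    show "finite (PiE {1..k} (\<lambda>i. {1..i}))" by (intro finite_PiE) auto
    show "?f ` {\<sigma>. \<sigma> permutes {1..k}} \<subseteq> PiE {1..k} (\<lambda>i. {1..i})"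
      using relative_rank_in_range by fastforce
    show "card (?f ` {\<sigma>. \<sigma> permutes {1..k}}) = card (PiE {1..k} (\<lambda>i. {1..i}))"
      using card_image[OF inj] by (simp add: card_permutations[of _ k] card_PiE fact_prod)
  qed
qed

text \<open>The bijection carries the event to the box \<open>PiE {1..k} F\<close>, and
  \<open>k!\<close> splits into the denominators \<open>i\<close>. The product form expresses
  independence and uniformity of the relative ranks.\<close>

lemma prob_relative_rank:
  assumes F: "\<And>i. i \<in> {1..k} \<Longrightarrow> F i \<subseteq> {1..i}"
  shows "measure_pmf.prob (pmf_of_set {\<sigma>. \<sigma> permutes {1..k}}) {\<sigma>. \<forall>i\<in>{1..k}. relative_rank \<sigma> i \<in> F i}
    = (\<Prod>i=1..k. real (card (F i)) / real i)"
proof -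
  let ?P = "{\<sigma>. \<sigma> permutes {1..k}}"
  let ?E = "{\<sigma>. \<forall>i\<in>{1..k}. relative_rank \<sigma> i \<in> F i}"
  let ?f = "\<lambda>\<sigma>. restrict (relative_rank \<sigma>) {1..k}"
  have "bij_betw ?f (?P \<inter> ?E) (PiE {1..k} F)"
  proof (rule bij_betw_subset[OF bij_betw_relative_rank])
    show "?P \<inter> ?E \<subseteq> ?P" by auto
    show "?f ` (?P \<inter> ?E) = PiE {1..k} F"
    proof
      show "?f ` (?P \<inter> ?E) \<subseteq> PiE {1..k} F" by auto
      show "PiE {1..k} F \<subseteq> ?f ` (?P \<inter> ?E)"
      proof
        fix g assume g: "g \<in> PiE {1..k} F"
        then have "g \<in> PiE {1..k} (\<lambda>i. {1..i})" using PiE_mono[of "{1..k}" F] F by blast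
        then have "g \<in> ?f ` ?P" using bij_betw_relative_rank[of k] by (simp add: bij_betw_def)
        then show "g \<in> ?f ` (?P \<inter> ?E)" using g by (force simp: PiE_def Pi_def)
      qed
    qed
  qed
  then have "card (?P \<inter> ?E) = (\<Prod>i=1..k. card (F i))"
    by (simp add: bij_betw_same_card card_PiE)
  then show ?thesis using finite_nonempty_permutations[of k]
    by (simp add: measure_pmf_of_set card_permutations[of _ k] prod_dividef fact_prod)
qed

lemma prob_random_horizon:
  assumes "n \<ge> 1"
  shows "measure_pmf.prob (random_horizon n) E =
    (\<Sum>k=1..n. measure_pmf.prob (pmf_of_set {\<sigma>. \<sigma> permutes {1..k}}) {\<sigma>. (k, \<sigma>) \<in> E}) / n"
proof -
  \<comment> \<open>As the expectation of an indicator, the probability can be conditioned on the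
    uniform number of applicants.\<close>
  have "measure_pmf.prob (random_horizon n) E = measure_pmf.expectation (random_horizon n) (indicator E)"
    by simp
  also have "\<dots> = (\<Sum>k=1..n. measure_pmf.expectation
        (map_pmf (Pair k) (pmf_of_set {\<sigma>. \<sigma> permutes {1..k}})) (indicator E) / n)"
    unfolding random_horizon_def using assms finite_nonempty_permutations
    by (subst pmf_expectation_bind_pmf_of_set) (auto simp: field_simps simp del: integral_map_pmf)
  also have "\<dots> = (\<Sum>k=1..n. measure_pmf.prob (pmf_of_set {\<sigma>. \<sigma> permutes {1..k}}) {\<sigma>. (k, \<sigma>) \<in> E} / n)"
    by (simp del: integral_map_pmf add: vimage_def)
  finally show ?thesis by (simp add: sum_divide_distrib)
qed

section \<open>Absolute ranks read off from relative ranks\<close>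

lemma relative_rank_eq_1_iff:
  assumes "i \<ge> 1"
  shows "relative_rank \<sigma> i = 1 \<longleftrightarrow> (\<forall>j\<in>{1..i}. \<sigma> j \<le> \<sigma> i \<longrightarrow> j = i)"
proof -
  have i: "i \<in> {j \<in> {1..i}. \<sigma> j \<le> \<sigma> i}" using assms by auto
  have "relative_rank \<sigma> i = 1 \<longleftrightarrow> (\<exists>x. {j \<in> {1..i}. \<sigma> j \<le> \<sigma> i} = {x})"
    unfolding relative_rank_def One_nat_def by (rule card_1_singleton_iff)
  also have "\<dots> \<longleftrightarrow> {j \<in> {1..i}. \<sigma> j \<le> \<sigma> i} = {i}" using i by (metis singletonD)
  also have "\<dots> \<longleftrightarrow> (\<forall>j\<in>{1..i}. \<sigma> j \<le> \<sigma> i \<longrightarrow> j = i)" using i by blast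
  finally show ?thesis .
qed

lemma relative_rank_eq_self_iff:
  assumes "i \<ge> 1"
  shows "relative_rank \<sigma> i = i \<longleftrightarrow> (\<forall>j\<in>{1..i}. \<sigma> j \<le> \<sigma> i)"
proof
  assume "relative_rank \<sigma> i = i"
  then have "{j \<in> {1..i}. \<sigma> j \<le> \<sigma> i} = {1..i}"
    by (intro card_subset_eq) (auto simp: relative_rank_def)
  then show "\<forall>j\<in>{1..i}. \<sigma> j \<le> \<sigma> i" by blast
next
  assume "\<forall>j\<in>{1..i}. \<sigma> j \<le> \<sigma> i"
  then have "{j \<in> {1..i}. \<sigma> j \<le> \<sigma> i} = {1..i}" by auto
  then show "relative_rank \<sigma> i = i" by (simp add: relative_rank_def)
qed

text \<open>The position \<open>m\<close> of the best applicant is the last one of relative rank 1: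
  whoever arrives later has \<open>m\<close> below.\<close>

lemma rank_eq_1_iff:
  assumes \<sigma>: "\<sigma> permutes {1..k}" and i: "i \<in> {1..k}"
  shows "\<sigma> i = 1 \<longleftrightarrow> relative_rank \<sigma> i = 1 \<and> (\<forall>j\<in>{i<..k}. relative_rank \<sigma> j \<noteq> 1)"
proof -
  have eq: "\<sigma> j = \<sigma> l \<longleftrightarrow> j = l" for j l using permutes_inj[OF \<sigma>] by (simp add: inj_eq)
  have pos: "\<sigma> j \<ge> 1" if "j \<in> {1..k}" for j using that permutes_in_image[OF \<sigma>, of j] by auto
  have "1 \<in> \<sigma> ` {1..k}" unfolding permutes_image[OF \<sigma>] using i by auto
  then obtain m where m: "m \<in> {1..k}" "\<sigma> m = 1" by (metis imageE)
  have le_m: "j = m" if "j \<in> {1..k}" "\<sigma> j \<le> \<sigma> m" for j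
  proof -
    have "\<sigma> j = \<sigma> m" using that(2) m pos[OF that(1)] by simp
    then show ?thesis using eq by blast
  qed
  have "{1..m} \<subseteq> {1..k}" "m \<ge> 1" using m by auto
  then have rm: "relative_rank \<sigma> m = 1" using le_m relative_rank_eq_1_iff[of m \<sigma>] by blast
  have later: "relative_rank \<sigma> j \<noteq> 1" if "j \<in> {m<..k}" for j
  proof
    assume "relative_rank \<sigma> j = 1"
    moreover have "m \<in> {1..j}" "\<sigma> m \<le> \<sigma> j" "m \<noteq> j" "j \<ge> 1" using that m pos[of j] by auto
    ultimately show False using relative_rank_eq_1_iff[of j \<sigma>] by blast
  qed
  show ?thesis
  proof
    assume "\<sigma> i = 1"
    then have "i = m" using m eq by metis
    then show "relative_rank \<sigma> i = 1 \<and> (\<forall>j\<in>{i<..k}. relative_rank \<sigma> j \<noteq> 1)" using rm later by blast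
  next
    assume r: "relative_rank \<sigma> i = 1 \<and> (\<forall>j\<in>{i<..k}. relative_rank \<sigma> j \<noteq> 1)"
    then have "\<not> i < m" "\<not> m < i" using rm later i m by auto
    then show "\<sigma> i = 1" using m by simp
  qed
qed

text \<open>Mirror image of \<open>rank_eq_1_iff\<close>: the position of the worst applicant is the
  last \<open>m\<close> with relative rank \<open>m\<close>.\<close>

lemma rank_eq_max_iff:
  assumes \<sigma>: "\<sigma> permutes {1..k}" and i: "i \<in> {1..k}"
  shows "\<sigma> i = k \<longleftrightarrow> relative_rank \<sigma> i = i \<and> (\<forall>j\<in>{i<..k}. relative_rank \<sigma> j \<noteq> j)"
proof -
  have eq: "\<sigma> j = \<sigma> l \<longleftrightarrow> j = l" for j l using permutes_inj[OF \<sigma>] by (simp add: inj_eq)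
  have le: "\<sigma> j \<le> k" if "j \<in> {1..k}" for j using that permutes_in_image[OF \<sigma>, of j] by auto
  have "k \<in> \<sigma> ` {1..k}" unfolding permutes_image[OF \<sigma>] using i by auto
  then obtain m where m: "m \<in> {1..k}" "\<sigma> m = k" by (metis imageE)
  have rm: "relative_rank \<sigma> m = m" using le m by (subst relative_rank_eq_self_iff) auto
  have later: "relative_rank \<sigma> j \<noteq> j" if "j \<in> {m<..k}" for j
  proof
    assume "relative_rank \<sigma> j = j"
    moreover have "m \<in> {1..j}" "m \<noteq> j" "j \<ge> 1" "j \<in> {1..k}" using that m by auto
    ultimately have "\<sigma> m \<le> \<sigma> j" using relative_rank_eq_self_iff[of j \<sigma>] by blast
    then have "\<sigma> j = \<sigma> m" using le[of j] \<open>j \<in> {1..k}\<close> m by simp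
    then show False using eq \<open>m \<noteq> j\<close> by simp
  qed
  show ?thesis
  proof
    assume "\<sigma> i = k"
    then have "i = m" using m eq by metis
    then show "relative_rank \<sigma> i = i \<and> (\<forall>j\<in>{i<..k}. relative_rank \<sigma> j \<noteq> j)" using rm later by blast
  next
    assume r: "relative_rank \<sigma> i = i \<and> (\<forall>j\<in>{i<..k}. relative_rank \<sigma> j \<noteq> j)"
    then have "\<not> i < m" "\<not> m < i" using rm later i m by auto
    then show "\<sigma> i = k" using m by simp
  qed
qed

text \<open>Let \<open>a\<close> and \<open>b\<close> be the positions of the best and the second
  best. After both have arrived every newcomer has relative rank at least 3, whereas
  \<open>a\<close> and \<open>b\<close> themselves never do. So the condition on later arrivals says
  that \<open>a\<close> and \<open>b\<close> are among the first \<open>i\<close>, and relative rank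
  2 then forces \<open>i = b\<close>.\<close>

lemma rank_eq_2_iff:
  assumes \<sigma>: "\<sigma> permutes {1..k}" and i: "i \<in> {1..k}" and r2: "relative_rank \<sigma> i = 2"
  shows "\<sigma> i = 2 \<longleftrightarrow> (\<forall>j\<in>{i<..k}. relative_rank \<sigma> j \<ge> 3)"
proof -
  have eq: "\<sigma> j = \<sigma> l \<longleftrightarrow> j = l" for j l using permutes_inj[OF \<sigma>] by (simp add: inj_eq)
  have pos: "\<sigma> j \<ge> 1" if "j \<in> {1..k}" for j using that permutes_in_image[OF \<sigma>, of j] by auto
  have k2: "k \<ge> 2" using r2 relative_rank_in_range[of i \<sigma>] i by auto
  have "1 \<in> \<sigma> ` {1..k}" "2 \<in> \<sigma> ` {1..k}" unfolding permutes_image[OF \<sigma>] using k2 by auto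
  then obtain a b where a: "a \<in> {1..k}" "\<sigma> a = 1" and b: "b \<in> {1..k}" "\<sigma> b = 2" by (metis imageE)
  have "a \<noteq> b" using a b by auto
  have ra: "relative_rank \<sigma> a = 1" using rank_eq_1_iff[OF \<sigma> a(1)] a by blast
  \<comment> \<open>Only an inclusion, because \<open>a\<close> may arrive after
    \<open>b\<close>.\<close>
  have "{l \<in> {1..b}. \<sigma> l \<le> \<sigma> b} \<subseteq> {a, b}"
  proof
    fix l assume "l \<in> {l \<in> {1..b}. \<sigma> l \<le> \<sigma> b}"
    then have "l \<in> {1..k}" "\<sigma> l \<le> 2" using b by auto
    then have "\<sigma> l = \<sigma> a \<or> \<sigma> l = \<sigma> b" using pos[of l] a b by linarith
    then show "l \<in> {a, b}" using eq by blast
  qed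
  then have "relative_rank \<sigma> b \<le> card {a, b}" unfolding relative_rank_def by (intro card_mono) auto
  then have rb: "relative_rank \<sigma> b \<le> 2" using \<open>a \<noteq> b\<close> by simp
  have ge3: "relative_rank \<sigma> j \<ge> 3" if "j \<in> {1..k}" "a \<le> j" "b \<le> j" "j \<noteq> a" "j \<noteq> b" for j
  proof -
    have "\<sigma> j \<noteq> 1" "\<sigma> j \<noteq> 2" using eq[of j a] eq[of j b] a b that by auto
    then have "\<sigma> j \<ge> 3" using pos[OF that(1)] by linarith
    then have "card {a, b, j} \<le> card {l \<in> {1..j}. \<sigma> l \<le> \<sigma> j}"
      by (intro card_mono) (use a b that in auto)
    moreover have "card {a, b, j} = 3" using that \<open>a \<noteq> b\<close> by auto
    ultimately show ?thesis by (simp add: relative_rank_def)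
  qed
  show ?thesis
  proof
    assume "\<sigma> i = 2"
    then have ib: "i = b" using b eq by metis
    \<comment> \<open>Someone better than \<open>i\<close> has already arrived, and only
      \<open>a\<close> is better.\<close>
    have "relative_rank \<sigma> i \<noteq> 1" using r2 by simp
    then obtain m where m: "m \<in> {1..i}" "\<sigma> m \<le> \<sigma> i" "m \<noteq> i"
      using relative_rank_eq_1_iff[of i \<sigma>] i by (metis atLeastAtMost_iff)
    then have "m \<in> {1..k}" "\<sigma> m \<noteq> \<sigma> i" using i eq by auto
    then have "\<sigma> m = \<sigma> a" using pos[of m] m \<open>\<sigma> i = 2\<close> a by linarith
    then have "a < i" using eq m by auto
    then show "\<forall>j\<in>{i<..k}. relative_rank \<sigma> j \<ge> 3" using ge3 ib i by auto
  next
    assume r: "\<forall>j\<in>{i<..k}. relative_rank \<sigma> j \<ge> 3"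
    then have "a \<notin> {i<..k}" "b \<notin> {i<..k}" using ra rb by force+
    then have "a \<le> i" "b \<le> i" using a b by auto
    then have "i = a \<or> i = b" using ge3[of i] i r2 by linarith
    then show "\<sigma> i = 2" using b ra r2 by auto
  qed
qed

section \<open>Success probabilities\<close>

text \<open>
  \<open>C i\<close> are the relative ranks of candidates, \<open>S i\<close> those that can win, and \<open>L j\<close> those of later arrivals
  that do not spoil the win.
\<close>
lemma prob_selection:
  fixes C S L :: "nat \<Rightarrow> nat set"
  assumes S: "\<And>i. i > r \<Longrightarrow> S i \<subseteq> C i \<inter> {1..i}" and L: "\<And>j. L j \<subseteq> {1..j}"
  shows "measure_pmf.prob (pmf_of_set {\<sigma>. \<sigma> permutes {1..k}})
      {\<sigma>. \<exists>i. threshold_selects r k (\<lambda>i. relative_rank \<sigma> i \<in> C i) i \<and>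
            relative_rank \<sigma> i \<in> S i \<and> (\<forall>j\<in>{i<..k}. relative_rank \<sigma> j \<in> L j)} =
    (\<Sum>i=Suc r..k. (\<Prod>j=Suc r..<i. real (card ({1..j} - C j)) / j) * (card (S i) / i) *
      (\<Prod>j=Suc i..k. real (card (L j)) / j))"
proof -
  \<comment> \<open>\<open>F i j\<close> holds the ranks allowed at time \<open>j\<close> if
    position \<open>i\<close> is to be selected and win. The rejection phase is unconstrained and
    contributes the factor 1.\<close>
  define F where "F i j = (if j \<le> r then {1..j} else if j < i then {1..j} - C j
    else if j = i then S i else L j)" for i j
  define E where "E i = {\<sigma>. \<forall>j\<in>{1..k}. relative_rank \<sigma> j \<in> F i j}" for i
  have E_iff: "\<sigma> \<in> E i \<longleftrightarrow> threshold_selects r k (\<lambda>i. relative_rank \<sigma> i \<in> C i) i \<and>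
      relative_rank \<sigma> i \<in> S i \<and> (\<forall>j\<in>{i<..k}. relative_rank \<sigma> j \<in> L j)"
    if i: "i \<in> {Suc r..k}" for i \<sigma>
  proof
    assume "\<sigma> \<in> E i"
    then have E: "relative_rank \<sigma> j \<in> F i j" if "1 \<le> j" "j \<le> k" for j using that by (auto simp: E_def)
    have "relative_rank \<sigma> i \<in> S i" using E[of i] i by (simp add: F_def)
    moreover have "relative_rank \<sigma> i \<in> C i" using calculation S[of i] i by auto
    moreover have "relative_rank \<sigma> j \<in> L j" if "j \<in> {i<..k}" for j
      using E[of j] i that by (simp add: F_def)
    moreover have "relative_rank \<sigma> j \<notin> C j" if "r < j" "j < i" for j
      using E[of j] i that by (simp add: F_def)
    ultimately show "threshold_selects r k (\<lambda>i. relative_rank \<sigma> i \<in> C i) i \<and>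
      relative_rank \<sigma> i \<in> S i \<and> (\<forall>j\<in>{i<..k}. relative_rank \<sigma> j \<in> L j)"
      using i by (auto simp: threshold_selects_def)
  next
    assume "threshold_selects r k (\<lambda>i. relative_rank \<sigma> i \<in> C i) i \<and>
      relative_rank \<sigma> i \<in> S i \<and> (\<forall>j\<in>{i<..k}. relative_rank \<sigma> j \<in> L j)"
    then show "\<sigma> \<in> E i" using relative_rank_in_range[of _ \<sigma>]
      by (auto simp: E_def F_def threshold_selects_def)
  qed
  have "{\<sigma>. \<exists>i. threshold_selects r k (\<lambda>i. relative_rank \<sigma> i \<in> C i) i \<and>
            relative_rank \<sigma> i \<in> S i \<and> (\<forall>j\<in>{i<..k}. relative_rank \<sigma> j \<in> L j)} = (\<Union>i\<in>{Suc r..k}. E i)"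
    (is "?A = _")
  proof -
    have "i \<in> {Suc r..k}" if "threshold_selects r k (\<lambda>i. relative_rank \<sigma> i \<in> C i) i" for i \<sigma>
      using that by (auto simp: threshold_selects_def)
    then show ?thesis using E_iff by blast
  qed
  \<comment> \<open>For \<open>i < j\<close> the event \<open>E i\<close> demands a candidate at
    \<open>i\<close>, which \<open>E j\<close> forbids.\<close>
  moreover have "disjoint_family_on E {Suc r..k}"
  proof -
    have "E i \<inter> E j = {}" if "i \<in> {Suc r..k}" "j \<in> {Suc r..k}" "i < j" for i j
      using E_iff[OF that(1)] E_iff[OF that(2)] that by (fastforce simp: threshold_selects_def)
    then show ?thesis unfolding disjoint_family_on_def by (metis Int_commute linorder_less_linear)
  qed
  ultimately have "measure_pmf.prob (pmf_of_set {\<sigma>. \<sigma> permutes {1..k}}) ?A =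
      (\<Sum>i=Suc r..k. measure_pmf.prob (pmf_of_set {\<sigma>. \<sigma> permutes {1..k}}) (E i))"
    by (simp add: measure_pmf.finite_measure_finite_Union)
  also have "\<dots> = (\<Sum>i=Suc r..k. (\<Prod>j=Suc r..<i. real (card ({1..j} - C j)) / j) * (card (S i) / i) *
      (\<Prod>j=Suc i..k. real (card (L j)) / j))"
  proof (rule sum.cong)
    fix i assume i: "i \<in> {Suc r..k}"
    have "measure_pmf.prob (pmf_of_set {\<sigma>. \<sigma> permutes {1..k}}) (E i) = (\<Prod>j=1..k. real (card (F i j)) / j)"
      unfolding E_def
    proof (rule prob_relative_rank)
      fix j show "F i j \<subseteq> {1..j}" using S[of i] L[of j] i by (auto simp: F_def)
    qed
    also have "\<dots> = (\<Prod>j=1..r. real (card (F i j)) / j) *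
        (\<Prod>j=Suc r..<i. real (card (F i j)) / j) * (card (F i i) / i) * (\<Prod>j=Suc i..k. real (card (F i j)) / j)"
    proof -
      have k: "{1..k} = {1..r} \<union> {Suc r..<i} \<union> {i} \<union> {Suc i..k}" using i by auto
      show ?thesis unfolding k by (subst prod.union_disjoint, simp, simp, use i in force)+ simp
    qed
    also have "(\<Prod>j=1..r. real (card (F i j)) / j) = 1"
      by (rule prod.neutral) (auto simp: F_def)
    also have "(\<Prod>j=Suc r..<i. real (card (F i j)) / j) = (\<Prod>j=Suc r..<i. real (card ({1..j} - C j)) / j)"
      by (rule prod.cong) (auto simp: F_def)
    also have "(\<Prod>j=Suc i..k. real (card (F i j)) / j) = (\<Prod>j=Suc i..k. real (card (L j)) / j)"
      using i by (intro prod.cong) (auto simp: F_def)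
    also have "F i i = S i" using i by (simp add: F_def)
    finally show "measure_pmf.prob (pmf_of_set {\<sigma>. \<sigma> permutes {1..k}}) (E i) = 
       (\<Prod>j=Suc r..<i. real (card ({1..j} - C j)) / j) * (card (S i) / i) *
      (\<Prod>j=Suc i..k. real (card (L j)) / j)" by simp
  qed auto
  finally show ?thesis .
qed

section \<open>Closed forms of the selection sums\<close>

text \<open>One more applicant multiplies every earlier selection by the chance of not being spoiled
  and adds a single new term, the selection of \<open>Suc k\<close>. Both closed forms follow from
  this recursion.\<close>

lemma selection_sum_Suc:
  fixes w s l :: "nat \<Rightarrow> 'a::comm_semiring_1"
  assumes "r \<le> k"
  shows "(\<Sum>i=Suc r..Suc k. (\<Prod>j=Suc r..<i. w j) * s i * (\<Prod>j=Suc i..Suc k. l j)) =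
    (\<Sum>i=Suc r..k. (\<Prod>j=Suc r..<i. w j) * s i * (\<Prod>j=Suc i..k. l j)) * l (Suc k) +
    (\<Prod>j=Suc r..<Suc k. w j) * s (Suc k)"
proof -
  have "(\<Sum>i=Suc r..k. (\<Prod>j=Suc r..<i. w j) * s i * (\<Prod>j=Suc i..Suc k. l j)) =
      (\<Sum>i=Suc r..k. (\<Prod>j=Suc r..<i. w j) * s i * (\<Prod>j=Suc i..k. l j) * l (Suc k))"
    by (rule sum.cong) (auto simp: prod.nat_ivl_Suc' mult_ac)
  then show ?thesis using assms by (simp add: sum.nat_ivl_Suc' sum_distrib_right add.commute)
qed

lemma best_selection_sum:
  assumes "1 \<le> r" "r \<le> k"
  shows "(\<Sum>i=Suc r..k. (\<Prod>j=Suc r..<i. (real j - 2) / j) * (1 / i) * (\<Prod>j=Suc i..k. (real j - 1) / j))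
    = real r * (real k - real r) / (real k * (real k - 1))"
  using assms(2)
proof (induction k rule: dec_induct)
  case base
  then show ?case by simp
next
  case (step k)
  \<comment> \<open>Telescoping, stated without division because
    \<open>real m * (real m - 1)\<close> vanishes at \<open>m = 1\<close>.\<close>
  have W: "(\<Prod>j=Suc r..<Suc m. (real j - 2) / j) * (real m * (real m - 1)) = real r * (real r - 1)"
    if "r \<le> m" for m
    using that
  proof (induction m rule: dec_induct)
    case (step m)
    have "(\<Prod>j=Suc r..<Suc (Suc m). (real j - 2) / j) * (real (Suc m) * (real (Suc m) - 1)) =
      (\<Prod>j=Suc r..<Suc m. (real j - 2) / j) * ((real (Suc m) - 2) / real (Suc m) * (real (Suc m) * (real (Suc m) - 1)))"
      using step by simp
    also have "(real (Suc m) - 2) / real (Suc m) * (real (Suc m) * (real (Suc m) - 1)) = real m * (real m - 1)"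
      by (simp add: field_simps)
    finally show ?case using step.IH by (simp only:)
  qed auto
  show ?case
  \<comment> \<open>At \<open>k = 1\<close> the denominator \<open>k * (k - 1)\<close> is 0, so the
    step to 2 is evaluated directly.\<close>
  proof (cases "k = 1")
    case True
    then have "r = 1" using step assms by simp
    then show ?thesis using True by simp
  next
    case False
    then have k: "k \<ge> 2" using step assms by simp
    then have "real k - 1 > 0" "real k > 0" by auto
    moreover from this have W': "(\<Prod>j=Suc r..<Suc k. (real j - 2) / j) = real r * (real r - 1) / (real k * (real k - 1))"
      using W[OF \<open>r \<le> k\<close>] by (subst nonzero_eq_divide_eq) auto
    ultimately show ?thesis
      unfolding selection_sum_Suc[OF \<open>r \<le> k\<close>] step.IH W'
      by (simp add: divide_simps) (simp add: algebra_simps power2_eq_square)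
  qed
qed

text \<open>The two kinds of factors of \<open>best_selection_sum\<close> are interchanged, yet the
  recursion has the same solution, since the first product telescopes to \<open>r / k\<close>. This
  is why Postdoc succeeds half as often as Best-or-Worst.\<close>

lemma second_selection_sum:
  assumes "1 \<le> r" "r \<le> k"
  shows "(\<Sum>i=Suc r..k. (\<Prod>j=Suc r..<i. (real j - 1) / j) * (1 / i) * (\<Prod>j=Suc i..k. (real j - 2) / j))
    = real r * (real k - real r) / (real k * (real k - 1))"
  using assms(2)
proof (induction k rule: dec_induct)
  case base
  then show ?case by simp
next
  case (step k)
  have W: "(\<Prod>j=Suc r..<Suc m. (real j - 1) / j) = real r / real m" if "r \<le> m" for m
    using that assms by (induction m rule: dec_induct) auto
  show ?case
  proof (cases "k = 1")
    case True
    then have "r = 1" using step assms by simp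
    then show ?thesis using True by simp
  next
    case False
    then have k: "k \<ge> 2" using step assms by simp
    then have "real k - 1 > 0" "real k > 0" by auto
    then show ?thesis
      unfolding selection_sum_Suc[OF \<open>r \<le> k\<close>] step.IH W[OF \<open>r \<le> k\<close>]
      by (simp add: divide_simps) (simp add: algebra_simps power2_eq_square)
  qed
qed

section \<open>Success probabilities for a fixed number of applicants\<close>

lemma prob_pmf_of_set_cong:
  assumes "finite S" "S \<noteq> {}" "\<And>x. x \<in> S \<Longrightarrow> x \<in> A \<longleftrightarrow> x \<in> B"
  shows "measure_pmf.prob (pmf_of_set S) A = measure_pmf.prob (pmf_of_set S) B"
proof -
  have "S \<inter> A = S \<inter> B" using assms(3) by blast
  then show ?thesis using assms by (simp add: measure_pmf_of_set)
qed

lemma threshold_selects_unique: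
  "threshold_selects r k C i \<Longrightarrow> threshold_selects r k C j \<Longrightarrow> i = j"
  unfolding threshold_selects_def by (metis linorder_less_linear)

text \<open>Winning with the best and winning with the worst applicant are disjoint instances of
  \<open>prob_selection\<close> of equal probability. For \<open>r = k\<close> both sides are 0,
  also at \<open>k = 1\<close>, where the division is by zero.\<close>

lemma prob_best_or_worst_fixed_horizon:
  assumes r: "1 \<le> r" "r \<le> k"
  shows "measure_pmf.prob (pmf_of_set {\<sigma>. \<sigma> permutes {1..k}})
      {\<sigma>. \<exists>i. threshold_selects r k (\<lambda>i. relative_rank \<sigma> i = 1 \<or> relative_rank \<sigma> i = i) i \<and>
          (\<sigma> i = 1 \<or> \<sigma> i = k)} = 2 * real r * (real k - real r) / (real k * (real k - 1))"
proof -
  let ?p = "pmf_of_set {\<sigma>. \<sigma> permutes {1..k}}"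
  define C where "C i = {1, i}" for i :: nat
  define A where "A S L = {\<sigma>. \<exists>i. threshold_selects r k (\<lambda>i. relative_rank \<sigma> i \<in> C i) i \<and>
            relative_rank \<sigma> i \<in> S i \<and> (\<forall>j\<in>{i<..k}. relative_rank \<sigma> j \<in> L j)}" for S L :: "nat \<Rightarrow> nat set"
  have C: "(relative_rank \<sigma> i = 1 \<or> relative_rank \<sigma> i = i) = (relative_rank \<sigma> i \<in> C i)" for \<sigma> i
    by (simp add: C_def)
  define best where "best = A (\<lambda>i. {1}) (\<lambda>j. {2..j})"
  define worst where "worst = A (\<lambda>i. {i}) (\<lambda>j. {1..j-1})"
  \<comment> \<open>The candidate ranks \<open>1\<close> and \<open>j\<close> are distinct, as
    \<open>j > r \<ge> 1\<close>.\<close>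
  have cardC: "real (card ({1..j} - C j)) = real j - 2" if "j \<ge> Suc r" for j
    using that r by (auto simp: C_def card_Diff_subset of_nat_diff)
  have p: "measure_pmf.prob ?p (A S L) = real r * (real k - real r) / (real k * (real k - 1))"
    if S: "\<And>i. i > r \<Longrightarrow> S i \<subseteq> C i \<inter> {1..i}" "\<And>i. card (S i) = 1"
      and L: "\<And>j. L j \<subseteq> {1..j}" "\<And>j. j \<ge> 1 \<Longrightarrow> real (card (L j)) = real j - 1" for S L
    unfolding A_def
  proof (subst prob_selection[of r S C L k, OF S(1) L(1)], assumption)
    show "(\<Sum>i=Suc r..k. (\<Prod>j=Suc r..<i. real (card ({1..j} - C j)) / j) * (card (S i) / i) *
      (\<Prod>j=Suc i..k. real (card (L j)) / j)) = real r * (real k - real r) / (real k * (real k - 1))"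
      unfolding best_selection_sum[OF r, symmetric]
      by (intro sum.cong refl arg_cong2[where f = "(*)"] prod.cong) (simp_all add: cardC S L del: One_nat_def)
  qed
  have pb: "measure_pmf.prob ?p best = real r * (real k - real r) / (real k * (real k - 1))"
    unfolding best_def by (rule p) (auto simp: C_def of_nat_diff)
  have pw: "measure_pmf.prob ?p worst = real r * (real k - real r) / (real k * (real k - 1))"
    unfolding worst_def by (rule p) (auto simp: C_def of_nat_diff)
  \<comment> \<open>The selected position exceeds \<open>r \<ge> 1\<close>, so its relative rank
    cannot equal both 1 and that position.\<close>
  have disj: "best \<inter> worst = {}"
  proof -
    have False if \<sigma>: "\<sigma> \<in> best" "\<sigma> \<in> worst" for \<sigma>
    proof -
      obtain i where i: "threshold_selects r k (\<lambda>i. relative_rank \<sigma> i \<in> C i) i" "relative_rank \<sigma> i = 1"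
        using \<sigma>(1) by (auto simp: best_def A_def)
      obtain j where j: "threshold_selects r k (\<lambda>i. relative_rank \<sigma> i \<in> C i) j" "relative_rank \<sigma> j = j"
        using \<sigma>(2) by (auto simp: worst_def A_def)
      have "i = j" using i j threshold_selects_unique by blast
      then show False using i j r by (simp add: threshold_selects_def)
    qed
    then show ?thesis by blast
  qed
  have "measure_pmf.prob ?p
      {\<sigma>. \<exists>i. threshold_selects r k (\<lambda>i. relative_rank \<sigma> i \<in> C i) i \<and> (\<sigma> i = 1 \<or> \<sigma> i = k)}
      = measure_pmf.prob ?p (best \<union> worst)"
  proof (rule prob_pmf_of_set_cong[OF finite_nonempty_permutations])
    fix \<sigma> assume "\<sigma> \<in> {\<sigma>. \<sigma> permutes {1..k}}"
    then have \<sigma>: "\<sigma> permutes {1..k}" by simp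
    have range: "relative_rank \<sigma> j \<in> {2..j} \<longleftrightarrow> relative_rank \<sigma> j \<noteq> 1"
      "relative_rank \<sigma> j \<in> {1..j-1} \<longleftrightarrow> relative_rank \<sigma> j \<noteq> j" if "j \<ge> 1" for j
      using relative_rank_in_range[OF that, of \<sigma>] by auto
    have "\<sigma> i = 1 \<longleftrightarrow> relative_rank \<sigma> i \<in> {1} \<and> (\<forall>j\<in>{i<..k}. relative_rank \<sigma> j \<in> {2..j})"
      "\<sigma> i = k \<longleftrightarrow> relative_rank \<sigma> i \<in> {i} \<and> (\<forall>j\<in>{i<..k}. relative_rank \<sigma> j \<in> {1..j-1})"
      if "threshold_selects r k (\<lambda>i. relative_rank \<sigma> i \<in> C i) i" for i
    proof -
      have i: "i \<in> {1..k}" using that r by (auto simp: threshold_selects_def)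
      have ge: "j \<ge> 1" if "j \<in> {i<..k}" for j using that by auto
      show "\<sigma> i = 1 \<longleftrightarrow> relative_rank \<sigma> i \<in> {1} \<and> (\<forall>j\<in>{i<..k}. relative_rank \<sigma> j \<in> {2..j})"
        unfolding rank_eq_1_iff[OF \<sigma> i] using range(1)[OF ge] by blast
      show "\<sigma> i = k \<longleftrightarrow> relative_rank \<sigma> i \<in> {i} \<and> (\<forall>j\<in>{i<..k}. relative_rank \<sigma> j \<in> {1..j-1})"
        unfolding rank_eq_max_iff[OF \<sigma> i] using range(2)[OF ge] by blast
    qed
    then show "\<sigma> \<in> {\<sigma>. \<exists>i. threshold_selects r k (\<lambda>i. relative_rank \<sigma> i \<in> C i) i \<and> (\<sigma> i = 1 \<or> \<sigma> i = k)}
        \<longleftrightarrow> \<sigma> \<in> best \<union> worst"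
      unfolding best_def worst_def A_def by blast
  qed
  also have "\<dots> = measure_pmf.prob ?p best + measure_pmf.prob ?p worst"
    using disj by (intro measure_pmf.finite_measure_Union) auto
  finally show ?thesis unfolding C pb pw by simp
qed

text \<open>An arrival \<open>j \<ge> 2\<close> has \<open>j - 1\<close> relative ranks that are not
  candidates and \<open>j - 2\<close> that do not displace a selected second best. These are the
  factors in \<open>second_selection_sum\<close>.\<close>

lemma prob_postdoc_fixed_horizon:
  assumes r: "1 \<le> r" "r \<le> k"
  shows "measure_pmf.prob (pmf_of_set {\<sigma>. \<sigma> permutes {1..k}})
      {\<sigma>. \<exists>i. threshold_selects r k (\<lambda>i. relative_rank \<sigma> i = 2) i \<and> \<sigma> i = 2}
      = real r * (real k - real r) / (real k * (real k - 1))"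
proof -
  let ?p = "pmf_of_set {\<sigma>. \<sigma> permutes {1..k}}"
  have "measure_pmf.prob ?p {\<sigma>. \<exists>i. threshold_selects r k (\<lambda>i. relative_rank \<sigma> i = 2) i \<and> \<sigma> i = 2}
    = measure_pmf.prob ?p {\<sigma>. \<exists>i. threshold_selects r k (\<lambda>i. relative_rank \<sigma> i \<in> {2}) i \<and>
            relative_rank \<sigma> i \<in> {2} \<and> (\<forall>j\<in>{i<..k}. relative_rank \<sigma> j \<in> {3..j})}"
  proof (rule prob_pmf_of_set_cong[OF finite_nonempty_permutations])
    fix \<sigma> assume "\<sigma> \<in> {\<sigma>. \<sigma> permutes {1..k}}"
    then have \<sigma>: "\<sigma> permutes {1..k}" by simp
    have range: "relative_rank \<sigma> j \<in> {3..j} \<longleftrightarrow> relative_rank \<sigma> j \<ge> 3" if "j \<ge> 1" for j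
      using relative_rank_in_range[OF that, of \<sigma>] by auto
    have "\<sigma> i = 2 \<longleftrightarrow> (\<forall>j\<in>{i<..k}. relative_rank \<sigma> j \<in> {3..j})" "relative_rank \<sigma> i = 2"
      if "threshold_selects r k (\<lambda>i. relative_rank \<sigma> i = 2) i" for i
    proof -
      have i: "i \<in> {1..k}" using that r by (auto simp: threshold_selects_def)
      have ge: "j \<ge> 1" if "j \<in> {i<..k}" for j using that by auto
      show r2: "relative_rank \<sigma> i = 2" using that by (simp add: threshold_selects_def)
      show "\<sigma> i = 2 \<longleftrightarrow> (\<forall>j\<in>{i<..k}. relative_rank \<sigma> j \<in> {3..j})"
        unfolding rank_eq_2_iff[OF \<sigma> i r2] using range[OF ge] by blast
    qed
    then show "\<sigma> \<in> {\<sigma>. \<exists>i. threshold_selects r k (\<lambda>i. relative_rank \<sigma> i = 2) i \<and> \<sigma> i = 2} \<longleftrightarrow>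
        \<sigma> \<in> {\<sigma>. \<exists>i. threshold_selects r k (\<lambda>i. relative_rank \<sigma> i \<in> {2}) i \<and>
            relative_rank \<sigma> i \<in> {2} \<and> (\<forall>j\<in>{i<..k}. relative_rank \<sigma> j \<in> {3..j})}"
      unfolding singleton_iff mem_Collect_eq by blast
  qed
  also have "\<dots> = (\<Sum>i=Suc r..k. (\<Prod>j=Suc r..<i. real (card ({1..j} - {2})) / j) * (card {2::nat} / i) *
      (\<Prod>j=Suc i..k. real (card {3..j}) / j))"
    using r by (intro prob_selection) auto
  also have "\<dots> = real r * (real k - real r) / (real k * (real k - 1))"
    unfolding second_selection_sum[OF r, symmetric] using r
    by (intro sum.cong refl arg_cong2[where f = "(*)"] prod.cong)
      (simp_all add: card_Diff_subset of_nat_diff)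
  finally show ?thesis .
qed


text \<open>The first arrival is both best and worst so far, so it is always selected. It wins with
  absolute rank 1 or \<open>k\<close>, each of probability \<open>1 / k\<close>; these two events
  coincide when \<open>k = 1\<close>.\<close>

lemma prob_best_or_worst_fixed_horizon_0:
  assumes k: "1 \<le> k"
  shows "measure_pmf.prob (pmf_of_set {\<sigma>. \<sigma> permutes {1..k}})
      {\<sigma>. \<exists>i. threshold_selects 0 k (\<lambda>i. relative_rank \<sigma> i = 1 \<or> relative_rank \<sigma> i = i) i \<and>
          (\<sigma> i = 1 \<or> \<sigma> i = k)} = (if k = 1 then 1 else 2 / k)"
proof -
  let ?p = "pmf_of_set {\<sigma>. \<sigma> permutes {1..k}}"
  have select: "threshold_selects 0 k (\<lambda>i. relative_rank \<sigma> i = 1 \<or> relative_rank \<sigma> i = i) i \<longleftrightarrow> i = 1" for \<sigma> i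
  proof -
    have "relative_rank \<sigma> 1 = 1" using relative_rank_in_range[of 1 \<sigma>] by auto
    then have "threshold_selects 0 k (\<lambda>i. relative_rank \<sigma> i = 1 \<or> relative_rank \<sigma> i = i) 1"
      using k by (auto simp: threshold_selects_def)
    then show ?thesis using threshold_selects_unique by blast
  qed
  have p: "measure_pmf.prob ?p {\<sigma>. \<sigma> 1 = v} = 1 / k" if v: "v = 1 \<or> v = k" for v
  proof -
    define L where "L j = (if v = 1 then {2..j} else {1..j-1})" for j :: nat
    define F where "F j = (if j = 1 then {1} else L j)" for j :: nat
    have "measure_pmf.prob ?p {\<sigma>. \<sigma> 1 = v} =
        measure_pmf.prob ?p {\<sigma>. \<forall>j\<in>{1..k}. relative_rank \<sigma> j \<in> F j}"
    proof (rule prob_pmf_of_set_cong[OF finite_nonempty_permutations])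
      fix \<sigma> assume "\<sigma> \<in> {\<sigma>. \<sigma> permutes {1..k}}"
      then have \<sigma>: "\<sigma> permutes {1..k}" by simp
      have r1: "relative_rank \<sigma> 1 = 1" using relative_rank_in_range[of 1 \<sigma>] by auto
      have one: "1 \<in> {1..k}" using k by simp
      have range: "relative_rank \<sigma> j \<in> {2..j} \<longleftrightarrow> relative_rank \<sigma> j \<noteq> 1"
        "relative_rank \<sigma> j \<in> {1..j-1} \<longleftrightarrow> relative_rank \<sigma> j \<noteq> j" if "j \<in> {1<..k}" for j
        using relative_rank_in_range[of j \<sigma>] that by auto
      have "\<sigma> 1 = v \<longleftrightarrow> (\<forall>j\<in>{1<..k}. relative_rank \<sigma> j \<in> L j)"
      proof (cases "v = 1")
        case True
        then show ?thesis using rank_eq_1_iff[OF \<sigma> one] r1 range(1) by (simp add: L_def)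
      next
        case False
        then have "v = k" "L = (\<lambda>j. {1..j-1})" using v by (auto simp: L_def)
        then show ?thesis using rank_eq_max_iff[OF \<sigma> one] r1 range(2) by simp
      qed
      also have "\<dots> \<longleftrightarrow> (\<forall>j\<in>{1..k}. relative_rank \<sigma> j \<in> F j)"
        using r1 unfolding F_def by (auto simp: Ball_def)
      finally show "\<sigma> \<in> {\<sigma>. \<sigma> 1 = v} \<longleftrightarrow> \<sigma> \<in> {\<sigma>. \<forall>j\<in>{1..k}. relative_rank \<sigma> j \<in> F j}" by simp
    qed
    also have "\<dots> = (\<Prod>j=1..k. real (card (F j)) / j)"
      by (rule prob_relative_rank) (auto simp: F_def L_def)
    \<comment> \<open>The factors after the first are \<open>(j - 1) / j\<close>, so the product
      telescopes.\<close>
    also have "\<dots> = 1 / k" using k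
    proof (induction k rule: dec_induct)
      case (step k)
      then show ?case by (auto simp: F_def L_def)
    qed (simp add: F_def)
    finally show ?thesis .
  qed
  have E: "{\<sigma>. \<exists>i. threshold_selects 0 k (\<lambda>i. relative_rank \<sigma> i = 1 \<or> relative_rank \<sigma> i = i) i \<and>
          (\<sigma> i = 1 \<or> \<sigma> i = k)} = {\<sigma>. \<sigma> 1 = 1} \<union> {\<sigma>. \<sigma> 1 = k}"
    unfolding select by auto
  show ?thesis
  proof (cases "k = 1")
    case True
    then show ?thesis unfolding E using p[of 1] by simp
  next
    case False
    then have "measure_pmf.prob ?p ({\<sigma>. \<sigma> 1 = 1} \<union> {\<sigma>. \<sigma> 1 = k}) = 1 / k + 1 / k"
      using p[of 1] p[of k] by (subst measure_pmf.finite_measure_Union) auto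
    then show ?thesis unfolding E using False by simp
  qed
qed

section \<open>Averaging over the random number of applicants\<close>

text \<open>For \<open>k > r\<close> the factor besides \<open>r\<close> is
  \<open>1 / (k - 1) - r * (1 / (k - 1) - 1 / k)\<close>: the first part sums to the harmonic tail,
  the second telescopes to \<open>r / n - 1\<close>.\<close>

lemma horizon_sum:
  assumes "1 \<le> r" "r \<le> n"
  shows "(\<Sum>k=1..n. if k \<le> r then 0 else real r * (real k - real r) / (real k * (real k - 1))) =
    r * ((\<Sum>j=r..<n. 1 / real j) + r / n - 1)"
  using assms(2)
proof (induction n rule: dec_induct)
  case base
  then show ?case using assms by simp
next
  case (step n)
  have n: "real n > 0" "real r > 0" using step assms by auto
  have "(\<Sum>k=1..Suc n. if k \<le> r then 0 else real r * (real k - real r) / (real k * (real k - 1))) =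
      real r * ((\<Sum>j=r..<n. 1 / real j) + r / n - 1) + r * (real (Suc n) - r) / (real (Suc n) * n)"
    using step by simp
  also have "\<dots> = r * ((\<Sum>j=r..<n. 1 / real j) + 1 / n + r / real (Suc n) - 1)"
    using n by (simp add: divide_simps) (simp add: algebra_simps)
  also have "(\<Sum>j=r..<n. 1 / real j) + 1 / n = (\<Sum>j=r..<Suc n. 1 / real j)" using step by simp
  finally show ?case .
qed

lemma best_or_worst_prob_eq_V:
  assumes "1 \<le> n" "r \<le> n"
  shows "best_or_worst_prob n r = V n r"
proof (cases "r = 0")
  case True
  have "best_or_worst_prob n 0 = (\<Sum>k=1..n. if k = 1 then 1 else 2 / real k) / n"
    unfolding best_or_worst_prob_def prob_random_horizon[OF assms(1)]
    by (intro arg_cong2[where f = "(/)"] sum.cong refl)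
      (simp add: prob_best_or_worst_fixed_horizon_0[unfolded One_nat_def])
  also have "(\<Sum>k=1..n. if k = 1 then 1 else 2 / real k) = 1 + (\<Sum>k=2..n. 2 / real k)"
    using assms by (subst sum.atLeast_Suc_atMost) (auto simp: numeral_2_eq_2 intro!: sum.cong)
  also have "\<dots> = 1 + 2 * (\<Sum>k=2..n. 1 / real k)" by (simp add: sum_distrib_left)
  finally show ?thesis using True by (simp add: V_def)
next
  case False
  then have r: "1 \<le> r" by simp
  have "best_or_worst_prob n r =
      (\<Sum>k=1..n. 2 * (if k \<le> r then 0 else real r * (real k - real r) / (real k * (real k - 1)))) / n"
    unfolding best_or_worst_prob_def prob_random_horizon[OF assms(1)]
  proof (intro arg_cong2[where f = "(/)"] sum.cong refl)
    fix k :: nat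
    show "measure_pmf.prob (pmf_of_set {\<sigma>. \<sigma> permutes {1..k}})
        {\<sigma>. (k, \<sigma>) \<in> {(k, \<sigma>). \<exists>i. threshold_selects r k
          (\<lambda>i. relative_rank \<sigma> i = 1 \<or> relative_rank \<sigma> i = i) i \<and> (\<sigma> i = 1 \<or> \<sigma> i = k)}} =
        2 * (if k \<le> r then 0 else real r * (real k - real r) / (real k * (real k - 1)))"
    proof (cases "k \<le> r")
      case True
      then have "\<not> threshold_selects r k C i" for C i by (auto simp: threshold_selects_def)
      then show ?thesis using True by simp
    next
      case False
      then have "r \<le> k" by simp
      then show ?thesis using prob_best_or_worst_fixed_horizon[OF r, of k] False by simp
    qed
  qed
  also have "\<dots> = V n r"
    unfolding sum_distrib_left[symmetric] horizon_sum[OF r assms(2)] using False by (simp add: V_def)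
  finally show ?thesis .
qed

lemma postdoc_prob_eq_half_V:
  assumes "1 \<le> r" "r \<le> n"
  shows "postdoc_prob n r = V n r / 2"
proof -
  have n: "1 \<le> n" using assms by simp
  have "postdoc_prob n r =
      (\<Sum>k=1..n. if k \<le> r then 0 else real r * (real k - real r) / (real k * (real k - 1))) / n"
    unfolding postdoc_prob_def prob_random_horizon[OF n]
  proof (intro arg_cong2[where f = "(/)"] sum.cong refl)
    fix k :: nat
    show "measure_pmf.prob (pmf_of_set {\<sigma>. \<sigma> permutes {1..k}})
        {\<sigma>. (k, \<sigma>) \<in> {(k, \<sigma>). \<exists>i. threshold_selects r k (\<lambda>i. relative_rank \<sigma> i = 2) i \<and> \<sigma> i = 2}} =
        (if k \<le> r then 0 else real r * (real k - real r) / (real k * (real k - 1)))"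
    proof (cases "k \<le> r")
      case True
      then have "\<not> threshold_selects r k C i" for C i by (auto simp: threshold_selects_def)
      then show ?thesis using True by simp
    next
      case False
      then have "r \<le> k" by simp
      then show ?thesis using prob_postdoc_fixed_horizon[OF assms(1), of k] False by simp
    qed
  qed
  also have "\<dots> = V n r / 2"
    unfolding horizon_sum[OF assms] using assms by (simp add: V_def)
  finally show ?thesis .
qed

lemma postdoc_prob_0: "postdoc_prob n 0 = postdoc_prob n 1"
proof -
  have "threshold_selects 0 k (\<lambda>i. relative_rank \<sigma> i = 2) i =
      threshold_selects 1 k (\<lambda>i. relative_rank \<sigma> i = 2) i" for k \<sigma> i
  proof -
    have "relative_rank \<sigma> 1 \<noteq> 2" using relative_rank_in_range[of 1 \<sigma>] by auto
    then show ?thesis unfolding threshold_selects_def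
      by (metis One_nat_def Suc_lessI less_trans zero_less_one)
  qed
  then show ?thesis by (simp add: postdoc_prob_def)
qed

section \<open>Sign changes of the differences\<close>

text \<open>Splitting the term \<open>1 / (r - 1)\<close> off the sum in \<open>V n (r - 1)\<close>
  leaves the same harmonic tail as in \<open>V n r\<close>. The bound \<open>2 \<le> r\<close> keeps
  \<open>r - 1\<close> away from the separate formula for threshold 0.\<close>

lemma D_eq:
  assumes "2 \<le> r" "r \<le> n"
  shows "D n r = real n * ((\<Sum>j=r..<n. 1 / real j) - 2) + 2 * real r - 1"
proof -
  obtain m where m: "r = Suc m" "m \<ge> 1" using assms by (cases r) auto
  have "(\<Sum>j=m..<n. 1 / real j) = 1 / real m + (\<Sum>j=Suc m..<n. 1 / real j)"
    using assms m by (intro sum.atLeast_Suc_lessThan) auto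
  then have V_m: "V n m = 2 * real m / real n * (1 / real m + (\<Sum>j=Suc m..<n. 1 / real j) + real m / real n - 1)"
    using m by (simp add: V_def)
  define S where "S = (\<Sum>j=Suc m..<n. 1 / real j)"
  have V_r: "V n (Suc m) = 2 * (real m + 1) / real n * (S + (real m + 1) / real n - 1)"
    by (simp add: V_def S_def add.commute)
  have "V n (Suc m) - V n m = 2 / real n * (S - 2 + (2 * real m + 1) / real n)"
    unfolding V_m V_r S_def[symmetric] using m assms by (simp add: field_simps)
  then have "D n (Suc m) = real n * (S - 2) + 2 * real m + 1"
    using assms by (simp add: D_def field_simps power2_eq_square)
  then show ?thesis using m by (simp add: S_def)
qed

lemma D_Suc:
  assumes "2 \<le> r" "r < n"
  shows "D n (Suc r) = D n r + 2 - real n / real r"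
proof -
  have "(\<Sum>j=r..<n. 1 / real j) = 1 / real r + (\<Sum>j=Suc r..<n. 1 / real j)"
    using assms by (intro sum.atLeast_Suc_lessThan) auto
  then show ?thesis using assms by (simp add: D_eq algebra_simps)
qed

lemma D_self: "2 \<le> n \<Longrightarrow> D n n = -1"
  by (simp add: D_eq)

lemma D_le_if_le_half:
  assumes "2 \<le> r" "r \<le> s" "2 * s \<le> n"
  shows "D n s \<le> D n r"
  using assms(2,3)
proof (induction s rule: dec_induct)
  case (step s)
  then have "D n (Suc s) = D n s + 2 - real n / real s" using assms by (intro D_Suc) auto
  moreover have "2 \<le> real n / real s" using step(1,4) assms(1) by (simp add: field_simps)
  ultimately show ?case using step by simp
qed auto

text \<open>Backward induction from \<open>D n n = -1\<close>: beyond \<open>n / 2\<close> the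
  increments \<open>2 - n / s\<close> are nonnegative.\<close>

lemma D_neg_if_ge_half:
  assumes "2 \<le> s" "s \<le> n" "n \<le> 2 * s"
  shows "D n s \<le> -1"
  using assms(2,1,3)
proof (induction s rule: inc_induct)
  case base
  then show ?case by (simp add: D_self)
next
  case (step s)
  then have "D n (Suc s) = D n s + 2 - real n / real s" by (intro D_Suc) auto
  moreover have "real n / real s \<le> 2" using step by (simp add: field_simps)
  ultimately show ?case using step by simp
qed

text \<open>Single crossing in usable form: once \<open>D n\<close> is nonpositive or negative it
  remains so, and a positive value forces all earlier ones to be positive.\<close>

lemma D_le_max:
  assumes "2 \<le> r" "r \<le> s" "s \<le> n"
  shows "D n s \<le> max (D n r) (-1)"
  using D_le_if_le_half[of r s n] D_neg_if_ge_half[of s n] assms by linarith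

section \<open>Unimodality and the unique maximizer\<close>

lemma V_diff_eq: "n \<ge> 1 \<Longrightarrow> V n r - V n (r - 1) = 2 * D n r / (real n)\<^sup>2"
  by (simp add: D_def)

lemma V_le_iff: "n \<ge> 1 \<Longrightarrow> V n r \<le> V n (r - 1) \<longleftrightarrow> D n r \<le> 0"
  using V_diff_eq[of n r] by (simp add: D_def mult_le_0_iff)

lemma V_less_iff: "n \<ge> 1 \<Longrightarrow> V n r < V n (r - 1) \<longleftrightarrow> D n r < 0"
  by (simp add: D_def mult_less_0_iff)

lemma unimodal_on_V:
  assumes n: "n \<ge> 1"
  shows "unimodal_on 1 n (V n)"
proof -
  \<comment> \<open>\<open>m\<close> is the last index reached by positive differences only; a zero
    difference already counts to the nonincreasing side.\<close>
  define m where "m = Max {r \<in> {1..n}. \<forall>s\<in>{2..r}. D n s > 0}"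
  have fin: "finite {r \<in> {1..n}. \<forall>s\<in>{2..r}. D n s > 0}" by simp
  have "1 \<in> {r \<in> {1..n}. \<forall>s\<in>{2..r}. D n s > 0}" using n by auto
  then have m: "m \<in> {1..n}" "\<And>s. s \<in> {2..m} \<Longrightarrow> D n s > 0"
    using Max_in[OF fin] unfolding m_def by blast+
  have neg: "D n s \<le> 0" if "m < s" "s \<le> n" for s
  proof -
    have "D n (Suc m) \<le> 0"
    proof (rule ccontr)
      assume "\<not> D n (Suc m) \<le> 0"
      then have "Suc m \<in> {r \<in> {1..n}. \<forall>s\<in>{2..r}. D n s > 0}" using m that by (auto simp: le_Suc_eq)
      then have "Suc m \<le> m" unfolding m_def using fin by (rule Max_ge[rotated])
      then show False by simp
    qed
    then show ?thesis using D_le_max[of "Suc m" s n] m that by force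
  qed
  have "mono_on {1..m} (V n)"
  proof (rule mono_onI)
    fix a b assume ab: "a \<in> {1..m}" "b \<in> {1..m}" "a \<le> b"
    show "V n a \<le> V n b" using ab(3,2)
    proof (induction b rule: dec_induct)
      case (step b)
      then have "D n (Suc b) > 0" using m ab by auto
      then show ?case using step ab(1) V_le_iff[OF n, of "Suc b"] by force
    qed auto
  qed
  moreover have "antimono_on {m..n} (V n)"
  proof (rule monotone_onI)
    fix a b assume ab: "a \<in> {m..n}" "b \<in> {m..n}" "a \<le> b"
    show "V n b \<le> V n a" using ab(3,2)
    proof (induction b rule: dec_induct)
      case (step b)
      then have "D n (Suc b) \<le> 0" using neg ab by auto
      then show ?case using step ab(1) V_le_iff[OF n, of "Suc b"] by force
    qed auto
  qed
  \<comment> \<open>Both ends of the plateau are taken to be \<open>m\<close>, so constancy concerns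
    one point.\<close>
  ultimately show ?thesis unfolding unimodal_on_def constant_on_def using m
    by (intro exI[of _ m]) auto
qed

text \<open>In \<open>V n 1\<close> the summand \<open>1 / n\<close> completes the harmonic sum up
  to \<open>n\<close> and \<open>- 1\<close> removes its first term, which leaves
  \<open>(2 / n) * (\<Sum>k=2..n. 1 / k)\<close>.\<close>

lemma V_0_eq:
  assumes "n \<ge> 1"
  shows "V n 0 = V n 1 + 1 / n"
proof -
  obtain m where m: "n = Suc m" using assms by (cases n) auto
  have "(\<Sum>j=1..<n. 1 / real j) + 1 / n = (\<Sum>j=1..n. 1 / real j)"
    unfolding m by (simp add: atLeastLessThanSuc_atLeastAtMost)
  moreover have "(\<Sum>j=1..n. 1 / real j) = 1 + (\<Sum>j=2..n. 1 / real j)"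
    using assms by (subst sum.atLeast_Suc_atMost) (auto simp: numeral_2_eq_2)
  ultimately show ?thesis using assms by (simp add: V_def field_simps)
qed

text \<open>Threshold 0 is better than threshold 1 by \<open>1 / n\<close>, so it lies outside the
  unimodal range; the increase from 1 to 2 has to make up for this.\<close>

lemma V_0_less_V_2:
  assumes "n \<ge> 13" "D n 4 > 0"
  shows "V n 0 < V n 2"
proof -
  have "D n 4 = D n 3 + 2 - real n / 3" "D n 3 = D n 2 + 2 - real n / 2"
    using D_Suc[of 3 n] D_Suc[of 2 n] assms by auto
  \<comment> \<open>\<open>D n 4 > 0\<close> gives \<open>D n 2 > 5 * n / 6 - 4\<close>, which is at
    least \<open>n / 2\<close> once \<open>n \<ge> 12\<close>.\<close>
  then have "D n 2 > n / 2" using assms by linarith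
  then have "2 * D n 2 / (real n)\<^sup>2 > n / (real n)\<^sup>2"
    by (intro divide_strict_right_mono) (use assms in auto)
  then have "V n 2 - V n 1 > 1 / n" using V_diff_eq[of n 2] assms
    by (simp add: power2_eq_square)
  then show ?thesis using V_0_eq[of n] assms by simp
qed

lemma V_unique_max:
  assumes n: "n \<ge> 13" and p: "4 \<le> p" "p < n"
    and D: "D n p > 0" "D n (p + 1) < 0" and r: "r \<le> n" "r \<noteq> p"
  shows "V n r < V n p"
proof -
  have pos: "D n s > 0" if "s \<in> {2..p}" for s
    using D_le_max[of s p n] that D p by auto
  have neg: "D n s < 0" if "s \<in> {p+1..n}" for s
    using D_le_max[of "p+1" s n] that D p by auto
  have up: "V n a \<le> V n b" if "1 \<le> a" "a \<le> b" "b \<le> p" for a b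
    using that(2,3)
  proof (induction b rule: dec_induct)
    case (step b)
    then have "D n (Suc b) > 0" using pos[of "Suc b"] that by auto
    then show ?case using step V_le_iff[of n "Suc b"] n by auto
  qed auto
  have down: "V n b \<le> V n a" if "p \<le> a" "a \<le> b" "b \<le> n" for a b
    using that(2,3)
  proof (induction b rule: dec_induct)
    case (step b)
    then have "D n (Suc b) < 0" using neg[of "Suc b"] that by auto
    then show ?case using step V_less_iff[of n "Suc b"] n by auto
  qed auto
  consider "r = 0" | "1 \<le> r" "r \<le> p - 1" | "p + 1 \<le> r" using r by linarith
  then show ?thesis
  proof cases
    case 1
    \<comment> \<open>Here \<open>p \<ge> 4\<close> enters; threshold 0 is compared with
      \<open>p\<close> by way of threshold 2.\<close>
    have "D n 4 > 0" using pos p by auto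
    then show ?thesis using 1 V_0_less_V_2[of n] up[of 2 p] n p by simp
  next
    case 2
    then show ?thesis using up[of r "p - 1"] V_le_iff[of n p] D n by auto
  next
    case 3
    then show ?thesis using down[of "p + 1" r] V_less_iff[of n "p + 1"] D n r by auto
  qed
qed

section \<open>Expansion at the rumour constant\<close>

lemma ln_less_minus_one:
  fixes x :: real
  assumes "0 < x" "x \<noteq> 1"
  shows "ln x < x - 1"
  using ln_le_minus_one[of x] ln_eq_minus_one[of x] assms by force

text \<open>For \<open>1 / 2 \<le> x < 1\<close> one has
  \<open>- ln x < 1 / x - 1 = (1 - x) / x \<le> 2 * (1 - x)\<close>, so the equation fails
  there.\<close>

lemma rumour_root_less:
  fixes x :: real
  assumes "0 < x" "x < 1" "- ln x = 2 * (1 - x)"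
  shows "x < 1 / 2"
proof (rule ccontr)
  assume "\<not> x < 1 / 2"
  have "ln (1 / x) < 1 / x - 1" using assms by (intro ln_less_minus_one) auto
  then have "2 * (1 - x) < 1 / x - 1" using assms by (simp add: ln_div)
  also have "\<dots> = (1 - x) * (1 / x)" using assms by (simp add: field_simps)
  also have "\<dots> \<le> (1 - x) * 2"
    using assms \<open>\<not> x < 1 / 2\<close> by (intro mult_left_mono) (auto simp: field_simps)
  finally show False by simp
qed

text \<open>The derivative \<open>1 / t - 2\<close> is nonnegative up to \<open>1 / 2\<close>; the
  tangent bound for \<open>ln (x / y)\<close> replaces the calculus.\<close>

lemma ln_minus_two_strict_mono:
  fixes x y :: real
  assumes "0 < x" "x < y" "y \<le> 1 / 2"
  shows "ln x - 2 * x < ln y - 2 * y"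
proof -
  have "ln (x / y) < x / y - 1" using assms by (intro ln_less_minus_one) auto
  moreover have "(y - x) * 2 \<le> (y - x) * (1 / y)"
    using assms by (intro mult_left_mono) (auto simp: field_simps)
  ultimately show ?thesis using assms by (simp add: ln_div algebra_simps diff_divide_distrib)
qed

lemma rumour_root_unique:
  "\<exists>!x::real. 0 < x \<and> x < 1 \<and> - ln x = 2 * (1 - x)"
proof (rule ex_ex1I)
  let ?g = "\<lambda>x::real. ln x - 2 * x"
  \<comment> \<open>The equation reads \<open>?g x = - 2\<close>. At \<open>exp (-2)\<close> the
    logarithm alone is \<open>- 2\<close>, and at \<open>1 / 2\<close> the value is
    \<open>- ln 2 - 1 > - 2\<close>.\<close>
  have "\<exists>x\<ge>exp (-2). x \<le> 1 / 2 \<and> ?g x = - 2"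
  proof (rule IVT')
    show "?g (exp (-2)) \<le> - 2" by simp
    have "ln 2 < (1::real)" using ln_less_minus_one[of 2] by simp
    then show "- 2 \<le> ?g (1 / 2)" by (simp add: ln_div)
    have "(2::real) \<le> exp 2" using exp_ge_add_one_self[of 2] by linarith
    then show "exp (-2) \<le> (1 / 2 :: real)" by (simp add: exp_minus field_simps)
    have "x \<noteq> 0" if "exp (-2) \<le> x" for x :: real using that exp_gt_zero[of "-2"] by linarith
    then show "continuous_on {exp (-2)..1 / 2} ?g" by (intro continuous_intros) auto
  qed
  then obtain x where "exp (-2) \<le> x" "x \<le> 1 / 2" "?g x = - 2" by blast
  moreover have "x > 0" using \<open>exp (-2) \<le> x\<close> exp_gt_zero[of "-2"] by linarith
  ultimately have "0 < x \<and> x < 1 \<and> - ln x = 2 * (1 - x)" by auto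
  then show "\<exists>x::real. 0 < x \<and> x < 1 \<and> - ln x = 2 * (1 - x)" by blast
next
  fix x y :: real
  assume x: "0 < x \<and> x < 1 \<and> - ln x = 2 * (1 - x)" and y: "0 < y \<and> y < 1 \<and> - ln y = 2 * (1 - y)"
  then have "x \<le> 1 / 2" "y \<le> 1 / 2" "ln x - 2 * x = ln y - 2 * y"
    using rumour_root_less[of x] rumour_root_less[of y] by auto
  then show "x = y"
    using ln_minus_two_strict_mono[of x y] ln_minus_two_strict_mono[of y x] x y
    by (metis linorder_less_linear order_less_irrefl)
qed

lemma rumour_const:
  "0 < rumour_const" "rumour_const < 1" "- ln rumour_const = 2 * (1 - rumour_const)"
  using theI'[OF rumour_root_unique] unfolding rumour_const_def by blast+

text \<open>This makes \<open>c\<close> positive. Otherwise monotonicity would give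
  \<open>ln 3 \<ge> 4 / 3\<close>, but
  \<open>exp (4 / 3) \<ge> 1 + 4 / 3 + 8 / 9 > 3\<close>.\<close>

lemma rumour_const_less_third: "rumour_const < 1 / 3"
proof (rule ccontr)
  assume "\<not> rumour_const < 1 / 3"
  then consider "1 / 3 = rumour_const" | "1 / 3 < rumour_const" by linarith
  then have "ln (1 / 3) - 2 * (1 / 3) \<le> ln rumour_const - 2 * rumour_const"
  proof cases
    case 1
    then show ?thesis by (simp only: order_refl)
  next
    case 2
    then show ?thesis
      using ln_minus_two_strict_mono[of "1 / 3" rumour_const] rumour_root_less[OF rumour_const] by simp
  qed
  then have "ln 3 \<ge> (4 / 3 :: real)" using rumour_const by (simp add: ln_div)
  then have "exp (4 / 3) \<le> (3 :: real)" by (metis exp_le_cancel_iff exp_ln zero_less_numeral)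
  moreover have "1 + 4 / 3 + (4 / 3)\<^sup>2 / 2 \<le> exp (4 / 3 :: real)" by (rule exp_lower_Taylor_quadratic) simp
  ultimately show False by (simp add: power2_eq_square)
qed

section \<open>Harmonic tails by the trapezoidal rule\<close>

text \<open>Inside the absolute value is the trapezoidal error for the integral of
  \<open>1 / t\<close> over \<open>[x, x + 1]\<close>. By convexity the integral lies between the
  midpoint and the trapezoidal value, and their gap is explicit.\<close>

lemma ln_step_error:
  fixes x :: real
  assumes "x > 0"
  shows "\<bar>1 / x - (ln (x + 1) - ln x) - (1 / x - 1 / (x + 1)) / 2\<bar> \<le> 1 / (4 * x ^ 3)"
proof -
  have up: "ln (x + 1) - ln x \<le> (1 / x + 1 / (x + 1)) / 2"
    using ln_inverse_approx_le[of x 1] assms by (simp add: inverse_eq_divide)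
  have "2 / (2 * x + 1) \<le> ln (x + 1) - ln x"
    using ln_inverse_approx_ge[of x "x + 1"] assms by (simp add: algebra_simps)
  moreover have "(1 / x + 1 / (x + 1)) / 2 - 2 / (2 * x + 1) = 1 / (2 * x * (x + 1) * (2 * x + 1))"
    using assms by (simp add: divide_simps) (simp add: algebra_simps)
  moreover have "1 / (2 * x * (x + 1) * (2 * x + 1)) \<le> 1 / (2 * x * x * (2 * x))"
    using assms by (intro divide_left_mono mult_mono) auto
  ultimately show ?thesis using up
    by (simp add: power3_eq_cube abs_le_iff field_simps)
qed

text \<open>The corrections telescope, and each of the \<open>n - r\<close> errors is at most the
  one at \<open>r\<close>. For \<open>r\<close> proportional to \<open>n\<close> the bound stays
  \<open>O(1 / n)\<close> after multiplication by \<open>n\<close>.\<close>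

lemma harmonic_tail_approx:
  assumes "1 \<le> r" "r \<le> n"
  shows "\<bar>(\<Sum>j=r..<n. 1 / real j) - ln (n / r) - (1 / r - 1 / n) / 2\<bar> \<le> real (n - r) / (4 * real r ^ 3)"
  using assms(2)
proof (induction n rule: dec_induct)
  case base
  then show ?case using assms by simp
next
  case (step n)
  have n: "real n > 0" "real r > 0" using step assms by auto
  have "1 / (4 * real n ^ 3) \<le> 1 / (4 * real r ^ 3)"
    using n step by (intro divide_left_mono mult_left_mono power_mono) auto
  then have step_bound: "\<bar>1 / real n - (ln (real n + 1) - ln (real n)) - (1 / real n - 1 / (real n + 1)) / 2\<bar>
      \<le> 1 / (4 * real r ^ 3)"
    using ln_step_error[OF n(1)] by linarith
  have diff_bound: "real (Suc n - r) / (4 * real r ^ 3) = real (n - r) / (4 * real r ^ 3) + 1 / (4 * real r ^ 3)"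
    using step by (simp add: Suc_diff_le add_divide_distrib)
  have "(\<Sum>j=r..<Suc n. 1 / real j) = (\<Sum>j=r..<n. 1 / real j) + 1 / real n" using step by simp
  moreover have "ln (real (Suc n) / r) = ln (real n + 1) - ln (real r)" "ln (real n / r) = ln (real n) - ln (real r)"
    using n by (simp_all add: ln_div add.commute)
  moreover have "1 / real (Suc n) = 1 / (real n + 1)" by (simp add: add.commute)
  ultimately have split: "(\<Sum>j=r..<Suc n. 1 / real j) - ln (Suc n / r) - (1 / r - 1 / Suc n) / 2 =
      ((\<Sum>j=r..<n. 1 / real j) - ln (n / r) - (1 / r - 1 / n) / 2) +
      (1 / real n - (ln (real n + 1) - ln (real n)) - (1 / real n - 1 / (real n + 1)) / 2)"
    by (simp only: diff_divide_distrib)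
  show ?case
    unfolding split diff_bound by (rule order_trans[OF abs_triangle_ineq add_mono[OF step.IH step_bound]])
qed

text \<open>With \<open>r = \<theta> * n * (1 + x)\<close> the equation for \<open>\<theta>\<close>
  cancels all terms of order \<open>n\<close>. The errors come from the harmonic tail
  (\<open>e1\<close>), from \<open>ln (1 + x) - x\<close> (\<open>e2\<close>) and from replacing
  \<open>r\<close> by \<open>\<theta> * n\<close> in \<open>n / (2 * r)\<close> (\<open>e3\<close>).
  The constant \<open>- 3 / 2\<close> is \<open>- 1\<close> from \<open>D_eq\<close> and
  \<open>- 1 / 2\<close> from the trapezoidal correction.\<close>

lemma D_expansion:
  fixes \<theta> u M :: real
  assumes \<theta>: "0 < \<theta>" "- ln \<theta> = 2 * (1 - \<theta>)" and n: "2 * M \<le> \<theta> * n" "1 \<le> n"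
    and r: "2 \<le> r" "r \<le> n" "real r = \<theta> * n + u" and u: "\<bar>u\<bar> \<le> M"
  shows "\<bar>D n r - ((2 - 1 / \<theta>) * u + (1 / (2 * \<theta>) - 3 / 2))\<bar>
    \<le> (2 / \<theta> ^ 3 + 2 * M\<^sup>2 / \<theta>\<^sup>2 + M / \<theta>\<^sup>2) / n"
proof -
  define H where "H = (\<Sum>j=r..<n. 1 / real j)"
  have n0: "real n > 0" and M0: "M \<ge> 0" using n u by auto
  \<comment> \<open>\<open>2 * M \<le> \<theta> * n\<close> keeps \<open>r\<close> above half of
    \<open>\<theta> * n\<close>, and \<open>x\<close> within \<open>1 / 2\<close>.\<close>
  have rpos: "real r \<ge> \<theta> * n / 2" "\<theta> * n / 2 > 0" using r(3) u n \<theta> n0 by auto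
  define x where "x = u / (\<theta> * n)"
  have x: "\<bar>x\<bar> \<le> 1 / 2" using u n \<theta> n0 by (simp add: x_def abs_mult field_simps)
  have "real r / n = \<theta> * (1 + x)" using r(3) n0 \<theta> by (simp add: x_def field_simps)
  then have "ln (real r / n) = ln \<theta> + ln (1 + x)" using \<theta> x by (simp add: ln_mult)
  then have lnr: "ln (n / r) = 2 * (1 - \<theta>) - ln (1 + x)" using \<theta> n0 r(1) by (simp add: ln_div)
  have e1: "\<bar>n * (H - ln (n / r) - (1 / r - 1 / n) / 2)\<bar> \<le> 2 / \<theta> ^ 3 / n"
  proof -
    have "\<bar>n * (H - ln (n / r) - (1 / r - 1 / n) / 2)\<bar> \<le> n * (real (n - r) / (4 * real r ^ 3))"
      unfolding abs_mult abs_of_nat H_def using harmonic_tail_approx[of r n] r n0 by (intro mult_left_mono) auto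
    also have "\<dots> \<le> n * (real n / (4 * (\<theta> * n / 2) ^ 3))"
      using rpos n0 by (intro mult_left_mono frac_le power_mono) auto
    also have "\<dots> = 2 / \<theta> ^ 3 / n" using n0 \<theta> by (simp add: field_simps power3_eq_cube)
    finally show ?thesis .
  qed
  have e2: "\<bar>n * (ln (1 + x) - x)\<bar> \<le> 2 * M\<^sup>2 / \<theta>\<^sup>2 / n"
  proof -
    have "\<bar>n * (ln (1 + x) - x)\<bar> \<le> n * (2 * x\<^sup>2)"
      unfolding abs_mult abs_of_nat using abs_ln_one_plus_x_minus_x_bound[OF x] by (intro mult_left_mono) auto
    also have "x\<^sup>2 \<le> M\<^sup>2 / (\<theta> * n)\<^sup>2"
      unfolding x_def power_divide using u M0 abs_le_square_iff[of u M] by (intro divide_right_mono) auto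
    also have "n * (2 * (M\<^sup>2 / (\<theta> * n)\<^sup>2)) = 2 * M\<^sup>2 / \<theta>\<^sup>2 / n"
      using n0 \<theta> by (simp add: field_simps power2_eq_square)
    finally show ?thesis using n0 by simp
  qed
  have e3: "\<bar>n / (2 * real r) - 1 / (2 * \<theta>)\<bar> \<le> M / \<theta>\<^sup>2 / n"
  proof -
    have "n / (2 * real r) - 1 / (2 * \<theta>) = - u / (2 * \<theta> * real r)"
      using rpos \<theta> n0 r(1) by (simp add: divide_simps) (simp add: r(3) algebra_simps)
    then have "\<bar>n / (2 * real r) - 1 / (2 * \<theta>)\<bar> = \<bar>u\<bar> / (2 * \<theta> * real r)"
      using \<theta> by (simp add: abs_mult)
    also have "\<dots> \<le> M / (2 * \<theta> * (\<theta> * n / 2))"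
      using u rpos \<theta> M0 by (intro frac_le mult_left_mono) auto
    also have "\<dots> = M / \<theta>\<^sup>2 / n" using \<theta> by (simp add: power2_eq_square)
    finally show ?thesis .
  qed
  have "D n r = n * (H - 2) + 2 * real r - 1" using D_eq[OF r(1,2)] by (simp add: H_def)
  moreover have "n * (1 / r - 1 / n) / 2 = n / (2 * real r) - 1 / 2" using n0 r(1) by (simp add: field_simps)
  moreover have "n * x = u / \<theta>" using n0 by (simp add: x_def)
  ultimately have "D n r - ((2 - 1 / \<theta>) * u + (1 / (2 * \<theta>) - 3 / 2)) =
      n * (H - ln (n / r) - (1 / r - 1 / n) / 2) - n * (ln (1 + x) - x) + (n / (2 * real r) - 1 / (2 * \<theta>))"
    unfolding lnr using r(3) n0 by (simp add: algebra_simps diff_divide_distrib)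
  moreover have "\<bar>a - b + d\<bar> \<le> a' + b' + d'" if "\<bar>a\<bar> \<le> a'" "\<bar>b\<bar> \<le> b'" "\<bar>d\<bar> \<le> d'" for a b d a' b' d' :: real
    using that by linarith
  ultimately show ?thesis using e1 e2 e3 by (simp only: add_divide_distrib)
qed

lemma D_uniform_approx:
  fixes \<theta> A c M :: real
  defines "\<theta> \<equiv> rumour_const"
  defines "A \<equiv> 2 - 1 / \<theta>"
  defines "c \<equiv> (1 - 3 * \<theta>) / (2 * (1 - 2 * \<theta>))"
  shows "\<exists>K n0. \<forall>n\<ge>n0. \<forall>u r. \<bar>u\<bar> \<le> M \<longrightarrow> r \<in> {2..n} \<longrightarrow> real r = \<theta> * real n + u \<longrightarrow>
    \<bar>D n r - A * (u - c)\<bar> \<le> K / real n"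
\<comment> \<open>The witnesses stay open: \<open>n0\<close> is fixed by the assumption on
  \<open>n\<close>, which yields \<open>2 * M \<le> \<theta> * n\<close>, and \<open>K\<close> by
  the bound of \<open>D_expansion\<close>.\<close>
proof (rule exI, rule exI, intro allI impI)
  have \<theta>: "0 < \<theta>" "\<theta> < 1 / 3" "- ln \<theta> = 2 * (1 - \<theta>)"
    using rumour_const rumour_const_less_third by (simp_all add: \<theta>_def)
  fix n r :: nat and u :: real
  assume n: "max 1 (nat \<lceil>2 * M / \<theta>\<rceil>) \<le> n" and u: "\<bar>u\<bar> \<le> M" and r: "r \<in> {2..n}" "real r = \<theta> * real n + u"
  have "2 * M / \<theta> \<le> n" using n by linarith
  then have "2 * M \<le> \<theta> * n" using \<theta> by (simp add: field_simps)
  moreover have "A * (u - c) = (2 - 1 / \<theta>) * u + (1 / (2 * \<theta>) - 3 / 2)"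
  proof -
    have "A * c = 3 / 2 - 1 / (2 * \<theta>)"
      unfolding A_def c_def using \<theta>(1,2) by (simp add: divide_simps) (simp add: algebra_simps)
    then show ?thesis by (simp add: A_def right_diff_distrib)
  qed
  ultimately show "\<bar>D n r - A * (u - c)\<bar> \<le> (2 / \<theta> ^ 3 + 2 * M\<^sup>2 / \<theta>\<^sup>2 + M / \<theta>\<^sup>2) / n"
    using D_expansion[of \<theta> M n r u] \<theta> n u r by simp
qed

text \<open>The linear approximation is \<open>\<delta> = - A * c > 0\<close> at 0 and below
  \<open>- \<delta>\<close> at 1. Moving by a small \<open>u\<close> and the error
  \<open>K / n\<close> each cost less than \<open>\<delta> / 2\<close>, so both signs
  persist.\<close>

lemma D_sign_change_near_rumour:
  "\<exists>\<epsilon>>0. \<exists>N. \<forall>n\<ge>N. \<forall>p. \<bar>real p - rumour_const * real n\<bar> < \<epsilon> \<longrightarrow>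
    13 \<le> n \<and> 4 \<le> p \<and> p < n \<and> D n p > 0 \<and> D n (p + 1) < 0"
proof -
  define \<theta> where "\<theta> = rumour_const"
  define A where "A = 2 - 1 / \<theta>"
  define c where "c = (1 - 3 * \<theta>) / (2 * (1 - 2 * \<theta>))"
  have \<theta>: "0 < \<theta>" "\<theta> < 1 / 3" using rumour_const rumour_const_less_third by (simp_all add: \<theta>_def)
  have A: "A < 0" using \<theta> by (simp add: A_def field_simps)
  have c: "0 < c" "c < 1 / 2" using \<theta> by (simp_all add: c_def field_simps)
  \<comment> \<open>The bound 2 covers both \<open>u\<close> and \<open>u + 1\<close> for
    \<open>\<bar>u\<bar> < 1\<close>.\<close>
  obtain K n0 where K: "\<And>n u r. n \<ge> n0 \<Longrightarrow> \<bar>u\<bar> \<le> 2 \<Longrightarrow> r \<in> {2..n} \<Longrightarrow> real r = \<theta> * real n + u \<Longrightarrow>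
    \<bar>D n r - A * (u - c)\<bar> \<le> K / real n"
    using D_uniform_approx[of 2] unfolding \<theta>_def A_def c_def by metis
  define \<delta> where "\<delta> = - A * c"
  have \<delta>: "\<delta> > 0" using A c by (simp add: \<delta>_def mult_neg_pos)
  define \<epsilon> where "\<epsilon> = min 1 (\<delta> / (2 * - A))"
  have \<epsilon>: "\<epsilon> > 0" using A \<delta> by (simp add: \<epsilon>_def field_simps)
  \<comment> \<open>13 is required by \<open>V_unique_max\<close>, \<open>5 / \<theta>\<close> gives
    \<open>p \<ge> 4\<close>, and \<open>2 * K / \<delta> + 1\<close> gives
    \<open>K / n < \<delta> / 2\<close>.\<close>
  obtain N where N: "real N \<ge> max (max 13 n0) (max (5 / \<theta>) (2 * K / \<delta> + 1))" using real_arch_simple by blast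
  have "13 \<le> n \<and> 4 \<le> p \<and> p < n \<and> D n p > 0 \<and> D n (p + 1) < 0"
    if n: "n \<ge> N" and p: "\<bar>real p - \<theta> * real n\<bar> < \<epsilon>" for n p
  proof -
    define u where "u = real p - \<theta> * real n"
    have u: "\<bar>u\<bar> < 1" "- A * \<bar>u\<bar> < \<delta> / 2" using p A by (auto simp: u_def \<epsilon>_def field_simps)
    have nN: "real n \<ge> 13" "real n \<ge> n0" "real n \<ge> 5 / \<theta>" "real n > 2 * K / \<delta>" using N n by auto
    have "\<theta> * n \<ge> 5" using nN(3) \<theta> by (simp add: field_simps)
    then have p4: "p \<ge> 4" using u by (simp add: u_def)
    have "\<theta> * n \<le> 1 / 3 * n" using \<theta> by (intro mult_right_mono) auto
    then have "real p < 1 / 3 * n + 1" using u(1) unfolding u_def by linarith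
    then have pn: "p + 1 < n" using nN(1) by linarith
    have Kn: "K / n < \<delta> / 2" using nN \<delta> by (simp add: field_simps)
    have Au: "\<bar>A * u\<bar> < \<delta> / 2" using u(2) A by (simp add: abs_mult)
    have "\<bar>D n p - A * (u - c)\<bar> \<le> K / n"
      using u nN pn p4 by (intro K) (auto simp: u_def)
    then have "D n p > 0" using Kn Au by (simp add: \<delta>_def algebra_simps)
    moreover have "\<bar>D n (p + 1) - A * (u + 1 - c)\<bar> \<le> K / n"
      using u nN pn p4 by (intro K) (auto simp: u_def)
    \<comment> \<open>As \<open>c < 1 / 2\<close>, the zero is closer to 0 than to 1, so the margin
      \<open>\<delta>\<close> also serves at \<open>p + 1\<close>.\<close>
    moreover have "A * (u + 1 - c) = A * u - \<delta> + A * (1 - 2 * c)" by (simp add: \<delta>_def algebra_simps)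
    moreover have "A * (1 - 2 * c) < 0" using A c by (intro mult_neg_pos) auto
    ultimately have "D n p > 0" "D n (p + 1) < 0" using Kn Au by linarith+
    then show ?thesis using p4 pn nN by auto
  qed
  then show ?thesis using \<epsilon> unfolding \<theta>_def by blast
qed

text \<open>The pairs are integers, thresholds are naturals; \<open>nat\<close> is injective on
  \<open>{0..q}\<close>, which transfers a strict maximum.\<close>

lemma unique_maximizer_natI:
  assumes "0 \<le> p" "p \<le> q" "\<And>r. r \<le> nat q \<Longrightarrow> r \<noteq> nat p \<Longrightarrow> f r < f (nat p)"
  shows "unique_maximizer (\<lambda>r. f (nat r)) {0..q} p"
proof -
  have "f (nat r) < f (nat p)" if "r \<in> {0..q}" "r \<noteq> p" for r
    using assms(3)[of "nat r"] that assms(1) by (simp add: nat_eq_iff nat_mono)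
  then show ?thesis using assms(1,2) unfolding unique_maximizer_def is_arg_max_def
    by (metis atLeastAtMost_iff order_less_asym order_less_irrefl)
qed

theorem mainTheorem9:
  fixes \<theta> A c :: real
  defines "\<theta> \<equiv> rumour_const"
  defines "A \<equiv> 2 - 1 / \<theta>"
  defines "c \<equiv> (1 - 3 * \<theta>) / (2 * (1 - 2 * \<theta>))"
  shows "(\<forall>n\<ge>1. unimodal_on 1 n (V n)) \<and>
    (A < 0 \<and> 0 < c \<and> c < 1 / 2 \<and>
      (\<forall>M>0. \<exists>K n0. \<forall>n\<ge>n0. \<forall>u r.
         \<bar>u\<bar> \<le> M \<longrightarrow> r \<in> {2..n} \<longrightarrow> real r = \<theta> * real n + u \<longrightarrow>
         \<bar>D n r - A * (u - c)\<bar> \<le> K / real n)) \<and>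
    (\<forall>p q :: nat \<Rightarrow> int.
       filterlim q at_top sequentially \<longrightarrow>
       (\<lambda>j. real_of_int (p j) - \<theta> * real_of_int (q j)) \<longlonglongrightarrow> 0 \<longrightarrow>
       (\<forall>\<^sub>F j in sequentially.
          unique_maximizer (\<lambda>r. V (nat (q j)) (nat r)) {0..q j} (p j) \<and>
          unique_maximizer (\<lambda>r. best_or_worst_prob (nat (q j)) (nat r)) {0..q j} (p j) \<and>
          unique_maximizer (\<lambda>r. postdoc_prob (nat (q j)) (nat r)) {0..q j} (p j)))"
proof (intro conjI allI impI)
  have \<theta>: "0 < \<theta>" "\<theta> < 1 / 3" using rumour_const rumour_const_less_third by (simp_all add: \<theta>_def)
  show "unimodal_on 1 n (V n)" if "1 \<le> n" for n using that by (rule unimodal_on_V)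
  show "A < 0" using \<theta> by (simp add: A_def field_simps)
  show "0 < c" "c < 1 / 2" using \<theta> by (simp_all add: c_def field_simps)
  show "\<exists>K n0. \<forall>n\<ge>n0. \<forall>u r. \<bar>u\<bar> \<le> M \<longrightarrow> r \<in> {2..n} \<longrightarrow> real r = \<theta> * real n + u \<longrightarrow>
         \<bar>D n r - A * (u - c)\<bar> \<le> K / real n" for M
    unfolding \<theta>_def A_def c_def by (rule D_uniform_approx)
  fix p q :: "nat \<Rightarrow> int"
  assume q: "filterlim q at_top sequentially"
    and pq: "(\<lambda>j. real_of_int (p j) - \<theta> * real_of_int (q j)) \<longlonglongrightarrow> 0"
  obtain \<epsilon> N where \<epsilon>: "\<epsilon> > 0" and N: "\<And>n r. n \<ge> N \<Longrightarrow> \<bar>real r - \<theta> * real n\<bar> < \<epsilon> \<Longrightarrow>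
      13 \<le> n \<and> 4 \<le> r \<and> r < n \<and> D n r > 0 \<and> D n (r + 1) < 0"
    using D_sign_change_near_rumour unfolding \<theta>_def by metis
  \<comment> \<open>Distance below 1 together with \<open>q j \<ge> 1 / \<theta>\<close> makes
    \<open>p j\<close> nonnegative, so that \<open>nat\<close> does not change it.\<close>
  have "\<forall>\<^sub>F j in sequentially. \<bar>real_of_int (p j) - \<theta> * real_of_int (q j)\<bar> < min \<epsilon> 1"
    using tendstoD[OF pq, of "min \<epsilon> 1"] \<epsilon> by (simp add: dist_real_def)
  moreover have "\<forall>\<^sub>F j in sequentially. q j \<ge> max (int N) \<lceil>1 / \<theta>\<rceil>"
    using q unfolding filterlim_at_top by blast
  ultimately show "\<forall>\<^sub>F j in sequentially.
          unique_maximizer (\<lambda>r. V (nat (q j)) (nat r)) {0..q j} (p j) \<and>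
          unique_maximizer (\<lambda>r. best_or_worst_prob (nat (q j)) (nat r)) {0..q j} (p j) \<and>
          unique_maximizer (\<lambda>r. postdoc_prob (nat (q j)) (nat r)) {0..q j} (p j)"
  proof eventually_elim
    case (elim j)
    define n r where "n = nat (q j)" and "r = nat (p j)"
    have "q j \<ge> 1 / \<theta>" using elim by linarith
    then have "\<theta> * q j \<ge> 1" using \<theta> by (simp add: field_simps)
    then have "p j \<ge> 0" using elim by linarith
    have "q j \<ge> 0" "n \<ge> N" using elim by (auto simp: n_def)
    then have "\<bar>real r - \<theta> * real n\<bar> < \<epsilon>" using elim \<open>p j \<ge> 0\<close> by (simp add: n_def r_def)
    then have nr: "13 \<le> n" "4 \<le> r" "r < n" "D n r > 0" "D n (r + 1) < 0" using N \<open>n \<ge> N\<close> by blast+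
    have V_less: "V n s < V n r" if "s \<le> n" "s \<noteq> r" for s using V_unique_max[OF nr that] .
    have "postdoc_prob n s < postdoc_prob n r" if s: "s \<le> n" "s \<noteq> r" for s
    proof -
      \<comment> \<open>Threshold 0 is replaced by the equivalent threshold 1, which still differs
        from \<open>r \<ge> 4\<close>.\<close>
      have "postdoc_prob n s = V n (max 1 s) / 2"
        using postdoc_prob_0[of n] postdoc_prob_eq_half_V[of "max 1 s" n] s nr by (cases "s = 0") auto
      also have "\<dots> < V n r / 2" using V_less[of "max 1 s"] s nr by (simp add: max_def)
      finally show ?thesis using postdoc_prob_eq_half_V[of r n] nr by simp
    qed
    moreover have "best_or_worst_prob n s < best_or_worst_prob n r" if "s \<le> n" "s \<noteq> r" for s
      using V_less[OF that] that nr by (simp add: best_or_worst_prob_eq_V)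
    moreover have "p j \<le> q j" using nr by (simp add: n_def r_def)
    ultimately show ?case using V_less \<open>p j \<ge> 0\<close>
      by (intro conjI unique_maximizer_natI) (auto simp: n_def r_def)
  qed
qed

end
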